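(* Let $\ell>0$, $\Omega=B_\ell(0)\subset\mathbb{C}$ and $z_0\in\Omega$. The map achieving $T(z_0)$ is given by $$u_{z_0}(z)=\begin{cases}\dfrac{2z}{\ell^2-\bar z_0z}&\text{if }z\in B_\ell(0),\\[2mm]\dfrac{2}{\bar z-\bar z_0}&\text{if }z\in\mathbb{C}\setminus B_\ell(0).\end{cases}$$ Its energy is given by $$T(z_0)=\frac{16\pi\ell^2}{(\ell^2-|z_0|^2)^2},$$ which is minimized (over $z_0\in\Omega$) by $z_0=0$ with $T(0)=\frac{16\pi}{\ell^2}$. The rescaled skyrmion radius is $r_0=\frac{\ell^2}{4}$ and the corresponding limiting energy is $\mathcal{E}_0\left(\mathrm{id},\frac{\ell^2}{4},0\right)=-\pi\ell^2$.
   Context: Identify $\mathbb{C}$ with $\mathbb{R}^2$. For $z_0\in\Omega$, $$T(z_0)=\inf\left\{\int_{\mathbb{R}^2}|\nabla u|^2dx: u\in H^1_{\mathrm{loc}}(\mathbb{R}^2;\mathbb{C}),\ u(z)=\frac{2}{\bar z-\bar z_0}\text{ in }\mathbb{C}\setminus\Omega\right\};$$ "the map achieving $T(z_0)$" is the minimizer of this problem and its energy is $\int_{\mathbb{R}^2}|\nabla u|^2dx=T(z_0)$. Let $e_3=(0,0,1)$ and $\Phi(x)=\left(-\frac{2x}{1+|x|^2},\frac{1-|x|^2}{1+|x|^2}\right)$ for $x\in\mathbb{R}^2$; for $v\in\mathbb{R}^3$ write $v=(v',v_3)$ with $v'\in\mathbb{R}^2$. For $R_0\in SO(3)$ with $R_0e_3=e_3$,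 $r_0>0$ and $z_0\in\Omega$, $$\mathcal{E}_0(R_0,r_0,z_0)=r_0^2T(z_0)-2r_0\int_{\mathbb{R}^2}(R_0\Phi)'\cdot\nabla\Phi_3\,dx.$$ The rescaled skyrmion radius is the minimizer $r_0=\frac{4\pi}{T(z_0)}$ of $r\mapsto\mathcal{E}_0(\mathrm{id},r,z_0)$ over $r>0$, taken at the minimizing center $z_0=0$. *)

theory Defs
  imports "HOL-Analysis.Analysis"
begin

text \<open>Throughout, the plane is the type \<^typ>\<open>complex\<close>, whose orthonormal
  \<^term>\<open>Basis\<close> consists of 1 and the imaginary unit.\<close>

fun C_k :: "nat \<Rightarrow> ('a::euclidean_space \<Rightarrow> real) \<Rightarrow> bool" where
  "C_k 0 f \<longleftrightarrow> continuous_on UNIV f"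
| "C_k (Suc k) f \<longleftrightarrow>
     (\<forall>x. f differentiable at x) \<and> (\<forall>e\<in>Basis. C_k k (\<lambda>x. frechet_derivative f (at x) e))"

definition test_function :: "('a::euclidean_space \<Rightarrow> real) \<Rightarrow> bool" where
  "test_function \<phi> \<longleftrightarrow> (\<forall>k. C_k k \<phi>) \<and> compact (closure {x. \<phi> x \<noteq> 0})"

definition locally_Lp :: "nat \<Rightarrow> ('a::euclidean_space \<Rightarrow> 'b::euclidean_space) \<Rightarrow> bool" where
  "locally_Lp p f \<longleftrightarrow> f \<in> borel_measurable lebesgue \<and>
     (\<forall>K. compact K \<longrightarrow> set_integrable lebesgue K (\<lambda>x. norm (f x) ^ p))"

text \<open>\<open>has_weak_partial u e g\<close>: the function \<open>g\<close> is a distributional derivative of \<open>u\<close> in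
  direction \<open>e\<close>. Local integrability makes both integrals below converge.\<close>

definition has_weak_partial ::
    "('a::euclidean_space \<Rightarrow> 'b::euclidean_space) \<Rightarrow> 'a \<Rightarrow> ('a \<Rightarrow> 'b) \<Rightarrow> bool" where
  "has_weak_partial u e g \<longleftrightarrow> locally_Lp 1 u \<and> locally_Lp 1 g \<and>
     (\<forall>\<phi>. test_function \<phi> \<longrightarrow>
        (\<integral>x. frechet_derivative \<phi> (at x) e *\<^sub>R u x \<partial>lebesgue) = - (\<integral>x. \<phi> x *\<^sub>R g x \<partial>lebesgue))"

definition H1_loc :: "('a::euclidean_space \<Rightarrow> 'b::euclidean_space) \<Rightarrow> bool" where
  "H1_loc u \<longleftrightarrow> locally_Lp 2 u \<and>
     (\<forall>e\<in>Basis. \<exists>g. locally_Lp 2 g \<and> has_weak_partial u e g)"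

text \<open>A weak derivative is unique up to a null set, so the choice does not affect the energy.\<close>

definition weak_partial ::
    "('a::euclidean_space \<Rightarrow> 'b::euclidean_space) \<Rightarrow> 'a \<Rightarrow> 'a \<Rightarrow> 'b" where
  "weak_partial u e = (SOME g. has_weak_partial u e g)"

definition dirichlet_energy :: "('a::euclidean_space \<Rightarrow> 'b::euclidean_space) \<Rightarrow> ennreal" where
  "dirichlet_energy u = (\<integral>\<^sup>+x. ennreal (\<Sum>e\<in>Basis. (norm (weak_partial u e x))\<^sup>2) \<partial>lebesgue)"

text \<open>Members of \<open>H1_loc\<close> are representatives of equivalence classes modulo null sets, so the
  exterior condition is imposed almost everywhere.\<close>

definition admissible :: "complex set \<Rightarrow> complex \<Rightarrow> (complex \<Rightarrow> complex) set" where
  "admissible \<Omega> z0 =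
     {u. H1_loc u \<and> (AE z in lebesgue. z \<notin> \<Omega> \<longrightarrow> u z = 2 / (cnj z - cnj z0))}"

definition T :: "complex set \<Rightarrow> complex \<Rightarrow> ennreal" where
  "T \<Omega> z0 = (INF u\<in>admissible \<Omega> z0. dirichlet_energy u)"

definition achieves_T :: "complex set \<Rightarrow> complex \<Rightarrow> (complex \<Rightarrow> complex) \<Rightarrow> bool" where
  "achieves_T \<Omega> z0 u \<longleftrightarrow> u \<in> admissible \<Omega> z0 \<and> dirichlet_energy u = T \<Omega> z0"

definition u_map :: "real \<Rightarrow> complex \<Rightarrow> complex \<Rightarrow> complex" where
  "u_map l z0 z =
     (if z \<in> ball 0 l then 2 * z / ((of_real l)\<^sup>2 - cnj z0 * z) else 2 / (cnj z - cnj z0))"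

definition Phi :: "complex \<Rightarrow> real ^ 3" where
  "Phi x = vector [- (2 * Re x) / (1 + (norm x)\<^sup>2),
                   - (2 * Im x) / (1 + (norm x)\<^sup>2),
                   (1 - (norm x)\<^sup>2) / (1 + (norm x)\<^sup>2)]"

definition horizontal :: "real ^ 3 \<Rightarrow> complex" where
  "horizontal v = Complex (v $ 1) (v $ 2)"

definition grad :: "('a::euclidean_space \<Rightarrow> real) \<Rightarrow> 'a \<Rightarrow> 'a" where
  "grad f x = (\<Sum>e\<in>Basis. frechet_derivative f (at x) e *\<^sub>R e)"

text \<open>Used for \<open>R0\<close> a rotation fixing the third basis vector, \<open>r0 > 0\<close> and \<open>z0 \<in> \<Omega>\<close>;
  the conversion \<^const>\<open>enn2real\<close> is faithful where \<open>T \<Omega> z0\<close> is finite. The inner product on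
  \<^typ>\<open>complex\<close> is the Euclidean one of the plane.\<close>

definition E0 :: "complex set \<Rightarrow> real ^ 3 ^ 3 \<Rightarrow> real \<Rightarrow> complex \<Rightarrow> real" where
  "E0 \<Omega> R0 r0 z0 = r0\<^sup>2 * enn2real (T \<Omega> z0)
     - 2 * r0 * (\<integral>x. horizontal (R0 *v Phi x) \<bullet> grad (\<lambda>y. Phi y $ 3) x \<partial>lebesgue)"

end

theory Submission
  imports Defs "HOL-Complex_Analysis.Complex_Analysis"
begin

text \<open>On the circle \<open>|z| = l\<close> one has \<open>cnj z = l\<^sup>2 / z\<close>, so the exterior datum continues holomorphically
  into the disc as \<open>2 z / (l\<^sup>2 - cnj z0 z)\<close>. A competitor differs from this map by a function \<open>w\<close>
  vanishing outside the disc, and the Dirichlet pairing of \<open>w\<close> with a map harmonic in a neighbourhood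
  of the closed disc is 0; hence the energy of a competitor exceeds the energy of the map by the
  Dirichlet energy of \<open>w\<close>. The energy itself is twice the area of the images of the disc and of its
  exterior, both of which are round discs of radius \<open>2 l / (l\<^sup>2 - |z0|\<^sup>2)\<close>.\<close>

section \<open>Smooth functions\<close>

text \<open>Competitors are only weakly differentiable, so every manipulation of a gradient has to
  go through real test functions that are smooth in the sense of \<open>C_k\<close>; hence the
  smooth calculus, the cutoffs and the bumps. The gradient of the minimiser jumps across the circle,
  but the map itself is Lipschitz on the plane, and this makes its pointwise derivative a weak one.
  The strict inequality |z0| < l puts the pole l^2 / cnj z0 of the inner branch beyond the closed
  disc, which leaves room for a cutoff. Uniqueness of the minimiser needs one more fact: a function
  vanishing outside a ball with one weak partial derivative equal to 0 is 0 almost everywhere. The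
  last numbers come from the integral in \<open>E0\<close>, which equals 4 pi: for the identity
  rotation the limiting energy is r^2 T - 8 pi r, with minimum -16 pi^2 / T at r = 4 pi / T, and T =
  16 pi / l^2 at the centre.\<close>

fun C_k_on :: "nat \<Rightarrow> 'a::euclidean_space set \<Rightarrow> ('a \<Rightarrow> real) \<Rightarrow> bool" where
  "C_k_on 0 S f \<longleftrightarrow> continuous_on S f"
| "C_k_on (Suc k) S f \<longleftrightarrow>
     (\<forall>x\<in>S. f differentiable at x) \<and> (\<forall>e\<in>Basis. C_k_on k S (\<lambda>x. frechet_derivative f (at x) e))"

text \<open>Smoothness is relative to an open set because the gradient of the inner branch is smooth
  only on a disc around the closed ball until a cutoff multiplies it. Derivatives are taken in the
  full space, so the notion is used for open sets only.\<close>

definition smooth_on :: "'a::euclidean_space set \<Rightarrow> ('a \<Rightarrow> real) \<Rightarrow> bool" where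
  "smooth_on S f \<longleftrightarrow> (\<forall>k. C_k_on k S f)"

lemma C_k_iff_C_k_on_UNIV: "C_k k f \<longleftrightarrow> C_k_on k UNIV f"
  by (induction k arbitrary: f) auto

lemma test_function_iff:
  "test_function f \<longleftrightarrow> smooth_on UNIV f \<and> compact (closure {x. f x \<noteq> 0})"
  by (simp add: test_function_def smooth_on_def C_k_iff_C_k_on_UNIV)

lemma C_k_on_cong:
  assumes "open S" "\<And>x. x \<in> S \<Longrightarrow> f x = g x" "C_k_on k S f"
  shows "C_k_on k S g"
  using assms(2,3)
proof (induction k arbitrary: f g)
  case 0
  then show ?case by (simp cong: continuous_on_cong)
next
  case (Suc k)
  have d: "(g has_derivative frechet_derivative f (at x)) (at x)" if "x \<in> S" for x
  proof (rule has_derivative_transform_within_open[OF _ \<open>open S\<close> that])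
    show "(f has_derivative frechet_derivative f (at x)) (at x)"
      using Suc.prems(2) that by (simp add: frechet_derivative_works)
  qed (use Suc.prems in auto)
  have eq: "frechet_derivative f (at x) = frechet_derivative g (at x)" if "x \<in> S" for x
    using d[OF that] frechet_derivative_at by blast
  have "g differentiable at x" if "x \<in> S" for x
    using d[OF that] unfolding differentiable_def by blast
  moreover have "C_k_on k S (\<lambda>x. frechet_derivative g (at x) e)" if "e \<in> Basis" for e
    by (rule Suc.IH[of "\<lambda>x. frechet_derivative f (at x) e"]) (use Suc.prems that eq in auto)
  ultimately show ?case by simp
qed

lemma C_k_on_lower: "C_k_on (Suc k) S f \<Longrightarrow> C_k_on k S f"
proof (induction k arbitrary: f)
  case 0
  then show ?case
    by (auto intro!: continuous_at_imp_continuous_on differentiable_imp_continuous_within)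
next
  case (Suc k)
  then show ?case by (metis C_k_on.simps(2))
qed

text \<open>Any explicit derivative may replace \<open>frechet_derivative\<close>. This turns each
  closure property below into an induction on the order, with the rule of differentiation as its
  step.\<close>

lemma C_k_on_SucI:
  assumes "open S" "\<And>x. x \<in> S \<Longrightarrow> (f has_derivative D x) (at x)"
    "\<And>e. e \<in> Basis \<Longrightarrow> C_k_on k S (\<lambda>x. D x e)"
  shows "C_k_on (Suc k) S f"
proof -
  have "frechet_derivative f (at x) = D x" if "x \<in> S" for x
    using assms(2)[OF that] frechet_derivative_at by metis
  then have "C_k_on k S (\<lambda>x. frechet_derivative f (at x) e)" if "e \<in> Basis" for e
    by (intro C_k_on_cong[OF assms(1) _ assms(3)[OF that]]) auto
  then show ?thesis using assms(2) by (auto simp: differentiable_def)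
qed

lemma C_k_on_has_derivative:
  "C_k_on (Suc k) S f \<Longrightarrow> x \<in> S \<Longrightarrow> (f has_derivative frechet_derivative f (at x)) (at x)"
  by (simp add: frechet_derivative_works)

lemma C_k_on_const: "open S \<Longrightarrow> C_k_on k S (\<lambda>x. c)"
  by (induction k arbitrary: c) (auto intro!: C_k_on_SucI[where D="\<lambda>x h. 0"])

lemma C_k_on_add:
  "\<lbrakk>open S; C_k_on k S f; C_k_on k S g\<rbrakk> \<Longrightarrow> C_k_on k S (\<lambda>x. f x + g x)"
proof (induction k arbitrary: f g)
  case 0
  then show ?case by (auto intro: continuous_on_add)
next
  case (Suc k)
  show ?case
  proof (rule C_k_on_SucI[OF Suc.prems(1)])
    show "((\<lambda>x. f x + g x) has_derivative
        (\<lambda>h. frechet_derivative f (at x) h + frechet_derivative g (at x) h)) (at x)" if "x \<in> S" for x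
      using Suc.prems that by (intro has_derivative_add C_k_on_has_derivative)
  qed (use Suc in auto)
qed

lemma C_k_on_mult:
  "\<lbrakk>open S; C_k_on k S f; C_k_on k S g\<rbrakk> \<Longrightarrow> C_k_on k S (\<lambda>x. f x * g x)"
proof (induction k arbitrary: f g)
  case 0
  then show ?case by (auto intro: continuous_on_mult)
next
  case (Suc k)
  show ?case
  proof (rule C_k_on_SucI[OF Suc.prems(1)])
    show "((\<lambda>x. f x * g x) has_derivative
        (\<lambda>h. f x * frechet_derivative g (at x) h + frechet_derivative f (at x) h * g x)) (at x)"
      if "x \<in> S" for x
      using Suc.prems that by (intro has_derivative_mult C_k_on_has_derivative)
    show "C_k_on k S (\<lambda>x. f x * frechet_derivative g (at x) e + frechet_derivative f (at x) e * g x)"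
      if "e \<in> Basis" for e
      using Suc.prems that by (intro C_k_on_add Suc.IH C_k_on_lower[of k S f] C_k_on_lower[of k S g]) auto
  qed
qed

lemma C_k_on_inverse:
  "\<lbrakk>open S; C_k_on k S f; \<And>x. x \<in> S \<Longrightarrow> f x \<noteq> 0\<rbrakk> \<Longrightarrow> C_k_on k S (\<lambda>x. inverse (f x))"
proof (induction k arbitrary: f)
  case 0
  then show ?case by (auto intro: continuous_on_inverse)
next
  case (Suc k)
  show ?case
  proof (rule C_k_on_SucI[OF Suc.prems(1)])
    show "((\<lambda>x. inverse (f x)) has_derivative
        (\<lambda>h. -1 * (inverse (f x) * frechet_derivative f (at x) h * inverse (f x)))) (at x)"
      if "x \<in> S" for x
      using Deriv.has_derivative_inverse[OF Suc.prems(3) C_k_on_has_derivative[OF Suc.prems(2)], of x] that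
      by simp
    show "C_k_on k S (\<lambda>x. -1 * (inverse (f x) * frechet_derivative f (at x) e * inverse (f x)))"
      if "e \<in> Basis" for e
      using Suc.prems that by (intro C_k_on_mult Suc.IH C_k_on_lower[of k S f] C_k_on_const) auto
  qed
qed

text \<open>The outer function is smooth of all orders, so its derivative satisfies the same
  hypothesis and the induction can run over \<open>f\<close>; the inner function stays fixed and
  only loses an order.\<close>

lemma C_k_on_compose:
  fixes f :: "real \<Rightarrow> real"
  shows "\<lbrakk>open S; smooth_on UNIV f; C_k_on k S g\<rbrakk> \<Longrightarrow> C_k_on k S (\<lambda>x. f (g x))"
proof (induction k arbitrary: f)
  case 0
  have "continuous_on UNIV f" using 0(2) by (metis C_k_on.simps(1) smooth_on_def)
  then show ?case using 0(3) by (auto intro: continuous_on_compose2)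
next
  case (Suc k)
  let ?f' = "\<lambda>t. frechet_derivative f (at t) 1"
  have fC: "C_k_on (Suc j) UNIV f" for j using Suc.prems(2) by (simp add: smooth_on_def del: C_k_on.simps)
  have f': "smooth_on UNIV ?f'" using fC by (auto simp: smooth_on_def)
  have fd: "(f has_derivative (\<lambda>h. ?f' t * h)) (at t)" for t
  proof -
    define D where "D = frechet_derivative f (at t)"
    have *: "(f has_derivative D) (at t)"
      using C_k_on_has_derivative[OF fC] unfolding D_def by blast
    have "h * D 1 = D h" for h
      using linear_scale[OF has_derivative_linear[OF *], of h 1] by simp
    then have "(f has_field_derivative D 1) (at t)"
      by (rule has_derivative_imp_has_field_derivative[OF *])
    then show ?thesis by (simp add: has_field_derivative_def D_def)
  qed
  show ?case
  proof (rule C_k_on_SucI[OF Suc.prems(1)])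
    show "((\<lambda>x. f (g x)) has_derivative (\<lambda>h. ?f' (g x) * frechet_derivative g (at x) h)) (at x)"
      if "x \<in> S" for x
      by (rule has_derivative_compose[OF C_k_on_has_derivative[OF Suc.prems(3) that] fd])
    show "C_k_on k S (\<lambda>x. ?f' (g x) * frechet_derivative g (at x) e)" if "e \<in> Basis" for e
      by (rule C_k_on_mult[OF Suc.prems(1) Suc.IH[OF Suc.prems(1) f' C_k_on_lower[OF Suc.prems(3)]]])
        (use Suc.prems(3) that in simp)
  qed
qed

lemma C_k_on_Un: "\<lbrakk>open S; open V; C_k_on k S f; C_k_on k V f\<rbrakk> \<Longrightarrow> C_k_on k (S \<union> V) f"
  by (induction k arbitrary: f) (auto intro: continuous_on_open_Un)

lemma C_k_on_subset: "C_k_on k S f \<Longrightarrow> V \<subseteq> S \<Longrightarrow> C_k_on k V f"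
  by (induction k arbitrary: f) (auto intro: continuous_on_subset)

lemma smooth_on_const: "open S \<Longrightarrow> smooth_on S (\<lambda>x. c)"
  by (simp add: smooth_on_def C_k_on_const)

lemma smooth_on_add: "\<lbrakk>open S; smooth_on S f; smooth_on S g\<rbrakk> \<Longrightarrow> smooth_on S (\<lambda>x. f x + g x)"
  by (simp add: smooth_on_def C_k_on_add)

lemma smooth_on_mult: "\<lbrakk>open S; smooth_on S f; smooth_on S g\<rbrakk> \<Longrightarrow> smooth_on S (\<lambda>x. f x * g x)"
  by (simp add: smooth_on_def C_k_on_mult)

lemma smooth_on_diff:
  assumes "open S" "smooth_on S f" "smooth_on S g"
  shows "smooth_on S (\<lambda>x. f x - g x)"
  using smooth_on_add[OF assms(1,2) smooth_on_mult[OF assms(1) smooth_on_const assms(3)], of "-1"]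
    assms(1) by simp

lemma smooth_on_divide:
  "\<lbrakk>open S; smooth_on S f; smooth_on S g; \<And>x. x \<in> S \<Longrightarrow> g x \<noteq> 0\<rbrakk> \<Longrightarrow> smooth_on S (\<lambda>x. f x / g x)"
  by (simp add: smooth_on_def C_k_on_mult C_k_on_inverse divide_inverse)

lemma smooth_on_compose:
  fixes f :: "real \<Rightarrow> real"
  shows "\<lbrakk>open S; smooth_on UNIV f; smooth_on S g\<rbrakk> \<Longrightarrow> smooth_on S (\<lambda>x. f (g x))"
  by (simp add: smooth_on_def C_k_on_compose)

lemma smooth_on_prod:
  "\<lbrakk>open S; \<And>i. i \<in> I \<Longrightarrow> smooth_on S (f i)\<rbrakk> \<Longrightarrow> smooth_on S (\<lambda>x. \<Prod>i\<in>I. f i x)"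
  by (induction I rule: infinite_finite_induct) (auto intro: smooth_on_const smooth_on_mult)

lemma smooth_on_cong:
  "\<lbrakk>open S; \<And>x. x \<in> S \<Longrightarrow> f x = g x; smooth_on S f\<rbrakk> \<Longrightarrow> smooth_on S g"
  by (meson C_k_on_cong smooth_on_def)

lemma smooth_on_Un: "\<lbrakk>open S; open V; smooth_on S f; smooth_on V f\<rbrakk> \<Longrightarrow> smooth_on (S \<union> V) f"
  by (simp add: smooth_on_def C_k_on_Un)

lemma smooth_on_subset: "smooth_on S f \<Longrightarrow> V \<subseteq> S \<Longrightarrow> smooth_on V f"
  unfolding smooth_on_def using C_k_on_subset by blast

lemma smooth_on_has_derivative:
  "smooth_on S f \<Longrightarrow> x \<in> S \<Longrightarrow> (f has_derivative frechet_derivative f (at x)) (at x)"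
  unfolding smooth_on_def using C_k_on_has_derivative by blast

lemma smooth_on_frechet_derivative:
  "smooth_on S f \<Longrightarrow> e \<in> Basis \<Longrightarrow> smooth_on S (\<lambda>x. frechet_derivative f (at x) e)"
  unfolding smooth_on_def by (metis C_k_on.simps(2))

lemma smooth_on_continuous: "smooth_on S f \<Longrightarrow> continuous_on S f"
  unfolding smooth_on_def by (metis C_k_on.simps(1))

lemma smooth_onI_antiderivative:
  fixes f :: "real \<Rightarrow> real"
  assumes "smooth_on UNIV f" "\<And>t. (F has_field_derivative f t) (at t)"
  shows "smooth_on UNIV F"
proof -
  have "C_k_on (Suc k) UNIV F" for k
  proof (rule C_k_on_SucI[where D="\<lambda>t h. f t * h"])
    show "(F has_derivative (\<lambda>h. f t * h)) (at t)" for t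
      using assms(2)[of t] by (simp add: has_field_derivative_def)
  qed (use assms(1) in \<open>auto simp: smooth_on_def\<close>)
  then show ?thesis unfolding smooth_on_def using C_k_on_lower by blast
qed

lemma smooth_on_linear:
  fixes f :: "'a::euclidean_space \<Rightarrow> real"
  assumes "bounded_linear f" "open S"
  shows "smooth_on S f"
proof -
  have "C_k_on (Suc k) S f" for k
    by (rule C_k_on_SucI[where D="\<lambda>x. f"])
      (use assms in \<open>auto intro!: C_k_on_const bounded_linear_imp_has_derivative\<close>)
  then show ?thesis unfolding smooth_on_def using C_k_on_lower by blast
qed

lemma smooth_on_norm_power2: "open S \<Longrightarrow> smooth_on S (\<lambda>x::'a::euclidean_space. (norm x)\<^sup>2)"
proof -
  assume S: "open S"
  have "C_k_on (Suc k) S (\<lambda>x::'a. (norm x)\<^sup>2)" for k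
  proof (rule C_k_on_SucI[OF S])
    show "((\<lambda>x::'a. (norm x)\<^sup>2) has_derivative (\<lambda>h. 2 * (x \<bullet> h))) (at x)" for x
      unfolding power2_norm_eq_inner by (auto intro!: derivative_eq_intros simp: inner_commute)
    show "C_k_on k S (\<lambda>x::'a. 2 * (x \<bullet> e))" for e
      using smooth_on_linear[OF bounded_linear_inner_left[of "2 *\<^sub>R e"] S] by (simp add: smooth_on_def)
  qed
  then show ?thesis unfolding smooth_on_def using C_k_on_lower by blast
qed

text \<open>The derivative of Re h in direction e is Re (h' e), again the real part of a holomorphic
  function, so the induction over all \<open>h\<close> closes.\<close>

lemma smooth_on_Re_holomorphic:
  assumes "open S" "h holomorphic_on S"
  shows "smooth_on S (\<lambda>z. Re (h z))"
proof -
  have "C_k_on k S (\<lambda>z. Re (h z))" for k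
    using assms(2)
  proof (induction k arbitrary: h)
    case 0
    then show ?case by (auto intro!: continuous_intros holomorphic_on_imp_continuous_on)
  next
    case (Suc k)
    show ?case
    proof (rule C_k_on_SucI[OF assms(1)])
      show "((\<lambda>z. Re (h z)) has_derivative (\<lambda>d. Re (deriv h z * d))) (at z)" if "z \<in> S" for z
        using holomorphic_derivI[OF Suc.prems assms(1) that]
        by (auto intro!: derivative_eq_intros simp: has_field_derivative_def)
      show "C_k_on k S (\<lambda>z. Re (deriv h z * e))" for e
        by (intro Suc.IH holomorphic_intros holomorphic_deriv Suc.prems assms(1))
    qed
  qed
  then show ?thesis by (simp add: smooth_on_def)
qed

lemma smooth_on_Im_holomorphic:
  assumes "open S" "h holomorphic_on S"
  shows "smooth_on S (\<lambda>z. Im (h z))"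
proof -
  have "(\<lambda>z. - \<i> * h z) holomorphic_on S" using assms(2) by (intro holomorphic_intros)
  from smooth_on_Re_holomorphic[OF assms(1) this] show ?thesis by simp
qed

section \<open>Cutoff functions and bumps\<close>

text \<open>The flat function exp (-1/t), with powers of 1/t attached so that the family spans a
  space closed under differentiation.\<close>

definition flat_exp :: "nat \<Rightarrow> real \<Rightarrow> real" where
  "flat_exp m t = (if t > 0 then exp (- inverse t) * inverse t ^ m else 0)"

lemma flat_exp_nonneg: "0 \<le> flat_exp m t"
  by (simp add: flat_exp_def)

lemma flat_exp_0_pos_iff: "0 < flat_exp 0 t \<longleftrightarrow> 0 < t"
  by (simp add: flat_exp_def)

lemma flat_exp_0_le_1: "flat_exp 0 t \<le> 1"
  by (simp add: flat_exp_def)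

lemma flat_exp_tendsto_0_at_0: "(flat_exp m \<longlongrightarrow> 0) (at 0)"
proof (rule filterlim_split_at)
  have "((\<lambda>t::real. inverse t ^ m / exp (inverse t)) \<longlongrightarrow> 0) (at_right 0)"
    by (rule filterlim_compose[OF tendsto_power_div_exp_0 filterlim_inverse_at_top_right])
  then show "(flat_exp m \<longlongrightarrow> 0) (at_right 0)"
    by (rule Lim_transform_eventually)
      (auto simp: flat_exp_def exp_minus divide_inverse mult.commute eventually_at_filter)
  have "((\<lambda>_. 0) \<longlongrightarrow> 0) (at_left (0::real))" by simp
  then show "(flat_exp m \<longlongrightarrow> 0) (at_left 0)"
    by (rule Lim_transform_eventually) (auto simp: flat_exp_def eventually_at_filter)
qed

lemma has_field_derivative_flat_exp:
  "(flat_exp m has_field_derivative flat_exp (m + 2) t - of_nat m * flat_exp (m + 1) t) (at t)"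
proof (cases t "0::real" rule: linorder_cases)
  case less
  have "((\<lambda>_. 0) has_field_derivative 0) (at t)" by simp
  then have "(flat_exp m has_field_derivative 0) (at t)"
    by (rule has_field_derivative_transform_within_open[where S="{..<0}"])
      (use less in \<open>auto simp: flat_exp_def\<close>)
  then show ?thesis using less by (simp add: flat_exp_def)
next
  case equal
  \<comment> \<open>The difference quotient of \<open>flat_exp m\<close> at 0 is
    \<open>flat_exp (Suc m)\<close> itself, which tends to 0.\<close>
  have "((\<lambda>h. (flat_exp m (0 + h) - flat_exp m 0) / h) \<longlongrightarrow> 0) (at 0)"
    by (rule Lim_transform_eventually[OF flat_exp_tendsto_0_at_0[of "Suc m"]])
      (auto simp: flat_exp_def eventually_at_filter divide_inverse)
  then show ?thesis using equal by (simp add: flat_exp_def DERIV_def)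
next
  case greater
  have "((\<lambda>t. exp (- inverse t) * inverse t ^ m) has_field_derivative
      flat_exp (m + 2) t - of_nat m * flat_exp (m + 1) t) (at t)"
  proof -
    have inv: "(inverse has_field_derivative - (inverse t * inverse t)) (at t)"
      using DERIV_inverse[of t UNIV] greater by (simp add: numeral_2_eq_2)
    \<comment> \<open>The truncated \<open>m - 1\<close> is harmless: at m = 0 the factor
      \<open>real m\<close> vanishes.\<close>
    have pow: "real m * inverse t ^ (m - 1) * inverse t = real m * inverse t ^ m"
      by (cases m) auto
    have "((\<lambda>t. exp (- inverse t) * inverse t ^ m) has_field_derivative
      exp (- inverse t) * (inverse t ^ (m + 2) - (real m * inverse t ^ (m - 1) * inverse t) * inverse t)) (at t)"
      by (rule DERIV_cong[OF DERIV_mult[OF DERIV_fun_exp[OF DERIV_minus[OF inv]] DERIV_power[OF inv]]])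
        (simp add: algebra_simps)
    then show ?thesis
      unfolding pow using greater by (simp add: flat_exp_def algebra_simps)
  qed
  then show ?thesis
    by (rule has_field_derivative_transform_within_open[where S="{0<..}"])
      (use greater in \<open>auto simp: flat_exp_def\<close>)
qed

lemma smooth_on_flat_exp: "smooth_on UNIV (flat_exp m)"
proof -
  have "C_k_on k UNIV (flat_exp m)" for k
  proof (induction k arbitrary: m)
    case 0
    have "isCont (flat_exp m) t" for t
      by (rule DERIV_isCont[OF has_field_derivative_flat_exp])
    then show ?case by (auto intro: continuous_at_imp_continuous_on)
  next
    case (Suc k)
    show ?case
    proof (rule C_k_on_SucI)
      show "(flat_exp m has_derivative
          (\<lambda>h. (flat_exp (m + 2) t + - real m * flat_exp (m + 1) t) * h)) (at t)" for t
        using has_field_derivative_flat_exp[of m t] by (simp add: has_field_derivative_def)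
      show "C_k_on k UNIV (\<lambda>t. (flat_exp (m + 2) t + - real m * flat_exp (m + 1) t) * e)" for e
        by (intro C_k_on_mult C_k_on_add C_k_on_const Suc.IH) auto
    qed simp
  qed
  then show ?thesis by (simp add: smooth_on_def)
qed

lemma exists_cutoff_function:
  fixes r R :: real
  assumes "0 \<le> r" "r < R"
  obtains \<eta> :: "'a::euclidean_space \<Rightarrow> real"
  where "smooth_on UNIV \<eta>" "\<And>x. norm x \<le> r \<Longrightarrow> \<eta> x = 1" "\<And>x. R \<le> norm x \<Longrightarrow> \<eta> x = 0"
proof
  \<comment> \<open>The squared norm keeps \<open>?s\<close> smooth at the origin. It is at least 1
    on the inner ball and at most 0 outside the outer one, and t \<mapsto> f(t) / (f(t) + f(1 - t))
    with f = \<open>flat_exp 0\<close> is a smooth step from 0 to 1 between these values.\<close>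
  let ?s = "\<lambda>x::'a. (R\<^sup>2 - (norm x)\<^sup>2) / (R\<^sup>2 - r\<^sup>2)"
  let ?\<eta> = "\<lambda>x. flat_exp 0 (?s x) / (flat_exp 0 (?s x) + flat_exp 0 (1 - ?s x))"
  have pos: "0 < R\<^sup>2 - r\<^sup>2" using assms by (simp add: power2_eq_square mult_strict_mono')
  have s: "smooth_on UNIV ?s"
    using pos by (intro smooth_on_divide smooth_on_diff smooth_on_const smooth_on_norm_power2) auto
  have "smooth_on UNIV (\<lambda>x. flat_exp 0 (?s x))"
    by (rule smooth_on_compose[OF _ smooth_on_flat_exp s]) simp
  moreover have "smooth_on UNIV (\<lambda>x. flat_exp 0 (1 - ?s x))"
    by (rule smooth_on_compose[OF _ smooth_on_flat_exp smooth_on_diff[OF _ smooth_on_const s]]) simp_all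
  moreover have "0 < flat_exp 0 t + flat_exp 0 (1 - t)" for t
    using flat_exp_0_pos_iff[of t] flat_exp_0_pos_iff[of "1 - t"] flat_exp_nonneg[of 0 t]
      flat_exp_nonneg[of 0 "1 - t"] by (cases "t > 0") auto
  ultimately show "smooth_on UNIV ?\<eta>"
    by (intro smooth_on_divide smooth_on_add) (auto simp: less_imp_neq[symmetric])
  show "?\<eta> x = 1" if "norm x \<le> r" for x
  proof -
    have "(norm x)\<^sup>2 \<le> r\<^sup>2" using that by (simp add: power_mono)
    then have "1 \<le> ?s x" using pos by simp
    then show ?thesis by (simp add: flat_exp_def)
  qed
  show "?\<eta> x = 0" if "R \<le> norm x" for x
  proof -
    have "R\<^sup>2 \<le> (norm x)\<^sup>2" using that assms by (simp add: power_mono)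
    then have "?s x \<le> 0" using pos by (simp add: divide_nonpos_pos)
    then show ?thesis by (simp add: flat_exp_def)
  qed
qed

lemma test_functionI:
  assumes "smooth_on UNIV f" "\<And>x. f x \<noteq> 0 \<Longrightarrow> x \<in> K" "compact K"
  shows "test_function f"
proof -
  have "closure {x. f x \<noteq> 0} \<subseteq> K"
    by (rule closure_minimal) (use assms in \<open>auto intro: compact_imp_closed\<close>)
  then have "compact (closure {x. f x \<noteq> 0})"
    using compact_Int_closed[OF assms(3) closed_closure[of "{x. f x \<noteq> 0}"]] by (simp add: inf.absorb2)
  with assms(1) show ?thesis by (simp add: test_function_iff)
qed

text \<open>The product is smooth on the ball where \<open>g\<close> is, and zero where the cutoff
  has ended; since R < R' these two open sets overlap and cover the space.\<close>

lemma test_function_mult_cutoff: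
  fixes \<eta> g :: "'a::euclidean_space \<Rightarrow> real"
  assumes "smooth_on UNIV \<eta>" "\<And>x. R \<le> norm x \<Longrightarrow> \<eta> x = 0" "smooth_on (ball 0 R') g" "R < R'"
  shows "test_function (\<lambda>x. \<eta> x * g x)"
proof (rule test_functionI)
  have "smooth_on (ball 0 R' \<union> - cball 0 R) (\<lambda>x. \<eta> x * g x)"
  proof (rule smooth_on_Un)
    show "smooth_on (ball 0 R') (\<lambda>x. \<eta> x * g x)"
      by (intro smooth_on_mult smooth_on_subset[OF assms(1)] assms(3)) auto
    show "smooth_on (- cball 0 R) (\<lambda>x. \<eta> x * g x)"
      by (rule smooth_on_cong[OF _ _ smooth_on_const[of _ 0]]) (use assms(2) in auto)
  qed auto
  moreover have "ball 0 R' \<union> - cball 0 R = (UNIV :: 'a set)" using assms(4) by auto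
  ultimately show "smooth_on UNIV (\<lambda>x. \<eta> x * g x)" by simp
  show "x \<in> cball 0 R" if "\<eta> x * g x \<noteq> 0" for x
    using that assms(2)[of x] by (cases "R \<le> norm x") auto
qed simp

text \<open>The factor n + 1 steepens both flanks while the bound 1 persists, so the bumps tend
  pointwise to the indicator of the open interval.\<close>

definition interval_bump :: "real \<Rightarrow> real \<Rightarrow> nat \<Rightarrow> real \<Rightarrow> real" where
  "interval_bump a b n t = flat_exp 0 (real (Suc n) * (t - a)) * flat_exp 0 (real (Suc n) * (b - t))"

text \<open>The product form later allows one coordinate factor to be replaced by its
  antiderivative.\<close>

definition box_bump :: "'a::euclidean_space \<Rightarrow> 'a \<Rightarrow> nat \<Rightarrow> 'a \<Rightarrow> real" where
  "box_bump a b n x = (\<Prod>i\<in>Basis. interval_bump (a \<bullet> i) (b \<bullet> i) n (x \<bullet> i))"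

lemma smooth_on_interval_bump: "smooth_on UNIV (interval_bump a b n)"
proof -
  have "smooth_on UNIV (\<lambda>t::real. c * (t - d))" "smooth_on UNIV (\<lambda>t::real. c * (d - t))" for c d
    by (rule smooth_on_mult[OF open_UNIV smooth_on_const smooth_on_diff];
        simp add: smooth_on_const smooth_on_linear)+
  then show ?thesis
    unfolding interval_bump_def[abs_def]
    by (rule smooth_on_mult[OF open_UNIV smooth_on_compose[OF open_UNIV smooth_on_flat_exp] smooth_on_compose[OF open_UNIV smooth_on_flat_exp]])
qed

lemma interval_bump_bounds: "0 \<le> interval_bump a b n t" "interval_bump a b n t \<le> 1"
  by (auto simp: interval_bump_def flat_exp_nonneg flat_exp_0_le_1 intro!: mult_le_one)

lemma interval_bump_eq_0: "t \<notin> {a<..<b} \<Longrightarrow> interval_bump a b n t = 0"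
  by (auto simp: interval_bump_def flat_exp_def zero_less_mult_iff)

lemma interval_bump_tendsto: "(\<lambda>n. interval_bump a b n t) \<longlonglongrightarrow> indicator {a<..<b} t"
proof (cases "t \<in> {a<..<b}")
  case True
  have "(\<lambda>n. flat_exp 0 (real (Suc n) * s)) \<longlonglongrightarrow> 1" if "s > 0" for s
  proof -
    have "(\<lambda>n. exp (- (inverse (real (Suc n)) * inverse s))) \<longlonglongrightarrow> exp (- (0 * inverse s))"
      by (intro tendsto_intros LIMSEQ_inverse_real_of_nat)
    then show ?thesis using that by (simp add: flat_exp_def zero_less_mult_iff)
  qed
  from tendsto_mult[OF this[of "t - a"] this[of "b - t"]] True
  show ?thesis by (simp add: interval_bump_def)
next
  case False
  then show ?thesis using interval_bump_eq_0[OF False] by simp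
qed

lemma box_bump_bounds: "0 \<le> box_bump a b n x" "box_bump a b n x \<le> 1"
  by (auto simp: box_bump_def interval_bump_bounds intro!: prod_nonneg prod_le_1)

lemma box_bump_eq_0: "x \<notin> box a b \<Longrightarrow> box_bump a b n x = 0"
  by (auto simp: box_bump_def mem_box intro!: prod_zero interval_bump_eq_0)

lemma smooth_on_box_bump: "smooth_on UNIV (box_bump a b n)"
  unfolding box_bump_def[abs_def]
  by (rule smooth_on_prod[OF open_UNIV smooth_on_compose[OF open_UNIV smooth_on_interval_bump
      smooth_on_linear[OF bounded_linear_inner_left open_UNIV]]])

lemma test_function_box_bump: "test_function (box_bump a b n)"
proof (rule test_functionI[OF smooth_on_box_bump])
  show "x \<in> cbox a b" if "box_bump a b n x \<noteq> 0" for x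
    using that box_bump_eq_0 box_subset_cbox[of a b] by (metis subsetD)
qed (rule compact_cbox)

lemma box_bump_tendsto: "(\<lambda>n. box_bump a b n x) \<longlonglongrightarrow> indicator (box a b) x"
proof -
  have "indicator (box a b) x = (\<Prod>i\<in>Basis. indicator {a \<bullet> i<..<b \<bullet> i} (x \<bullet> i) :: real)"
  proof (cases "x \<in> box a b")
    case True
    then show ?thesis by (simp add: mem_box)
  next
    case False
    then have "\<exists>i\<in>Basis. indicator {a \<bullet> i<..<b \<bullet> i} (x \<bullet> i) = (0::real)"
      by (metis (no_types, opaque_lifting) greaterThanLessThan_iff indicator_simps(2) mem_box(1))
    then have "(\<Prod>i\<in>Basis. indicator {a \<bullet> i<..<b \<bullet> i} (x \<bullet> i) :: real) = 0"
      by (rule prod_zero[OF finite_Basis])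
    with False show ?thesis by simp
  qed
  then show ?thesis
    unfolding box_bump_def by (simp add: tendsto_prod interval_bump_tendsto)
qed

section \<open>The fundamental lemma of the calculus of variations\<close>

lemma test_function_smooth_on: "test_function \<phi> \<Longrightarrow> smooth_on UNIV \<phi>"
  by (simp add: test_function_iff)

lemma test_function_has_derivative:
  "test_function \<phi> \<Longrightarrow> (\<phi> has_derivative frechet_derivative \<phi> (at x)) (at x)"
  by (rule smooth_on_has_derivative[OF test_function_smooth_on]) auto

lemma test_function_continuous: "test_function \<phi> \<Longrightarrow> continuous_on UNIV \<phi>"
  by (rule smooth_on_continuous[OF test_function_smooth_on])

lemma frechet_derivative_eq_0_outside:
  fixes f :: "'a::euclidean_space \<Rightarrow> real"
  assumes "closed K" "\<And>y. y \<notin> K \<Longrightarrow> f y = 0" "x \<notin> K"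
  shows "frechet_derivative f (at x) = (\<lambda>h. 0)"
proof -
  have "(f has_derivative (\<lambda>h. 0)) (at x)"
    by (rule has_derivative_transform_within_open[OF has_derivative_const, of "- K"])
      (use assms in auto)
  then show ?thesis using frechet_derivative_at by metis
qed

lemma test_function_derivative:
  assumes "test_function \<phi>" "e \<in> Basis"
  shows "test_function (\<lambda>x. frechet_derivative \<phi> (at x) e)"
proof (rule test_functionI)
  show "smooth_on UNIV (\<lambda>x. frechet_derivative \<phi> (at x) e)"
    by (intro smooth_on_frechet_derivative test_function_smooth_on assms)
  show "x \<in> closure {x. \<phi> x \<noteq> 0}" if "frechet_derivative \<phi> (at x) e \<noteq> 0" for x
  proof (rule ccontr)
    assume "x \<notin> closure {x. \<phi> x \<noteq> 0}"
    then have "frechet_derivative \<phi> (at x) = (\<lambda>h. 0)"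
      using closure_subset[of "{x. \<phi> x \<noteq> 0}"]
      by (intro frechet_derivative_eq_0_outside[of "closure {x. \<phi> x \<noteq> 0}"]) auto
    then show False using that by simp
  qed
  show "compact (closure {x. \<phi> x \<noteq> 0})" using assms(1) by (simp add: test_function_iff)
qed

lemma test_function_bounds:
  fixes \<phi> :: "'a::euclidean_space \<Rightarrow> real"
  assumes "test_function \<phi>"
  obtains R C where "0 < R" "0 \<le> C" "\<And>x. R \<le> norm x \<Longrightarrow> \<phi> x = 0" "\<And>x. \<bar>\<phi> x\<bar> \<le> C"
proof -
  let ?K = "closure {x. \<phi> x \<noteq> 0}"
  have K: "compact ?K" using assms by (simp add: test_function_iff)
  obtain R where R: "\<And>x. x \<in> ?K \<Longrightarrow> norm x \<le> R"
    using compact_imp_bounded[OF K] unfolding bounded_iff by blast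
  have im: "compact (\<phi> ` ?K)"
    by (rule compact_continuous_image[OF continuous_on_subset[OF test_function_continuous[OF assms]] K])
      simp
  then obtain C where C: "\<And>x. x \<in> ?K \<Longrightarrow> \<bar>\<phi> x\<bar> \<le> C"
    using compact_imp_bounded[OF im] unfolding bounded_iff by auto
  have out: "\<phi> x = 0" if "x \<notin> ?K" for x
    using that closure_subset[of "{x. \<phi> x \<noteq> 0}"] by blast
  \<comment> \<open>\<open>R + 1\<close> places points with norm equal to the new radius strictly
    outside the support; the maxima supply the signs even when the support is empty.\<close>
  show ?thesis
  proof (rule that[of "max 1 (R + 1)" "max 0 C"])
    show "\<phi> x = 0" if "max 1 (R + 1) \<le> norm x" for x
    proof (rule out)
      show "x \<notin> ?K" using R[of x] that by auto
    qed
    show "\<bar>\<phi> x\<bar> \<le> max 0 C" for x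
      using out[of x] C[of x] by (cases "x \<in> ?K") auto
  qed auto
qed

lemma locally_Lp_1_integrable:
  assumes "locally_Lp 1 f" "compact K"
  shows "integrable lebesgue (\<lambda>x. indicator K x *\<^sub>R f x)"
proof -
  have "integrable lebesgue (\<lambda>x. norm (indicator K x *\<^sub>R f x))"
    using assms by (auto simp: locally_Lp_def set_integrable_def)
  moreover have "(\<lambda>x. indicator K x *\<^sub>R f x) \<in> borel_measurable lebesgue"
    using assms by (intro borel_measurable_scaleR borel_measurable_indicator)
      (auto simp: locally_Lp_def intro!: lmeasurable_compact fmeasurableD)
  ultimately show ?thesis by (rule integrable_norm_cancel)
qed

lemma locally_Lp_1_integrable_scaleR:
  assumes "locally_Lp 1 f" "compact K" "\<phi> \<in> borel_measurable lebesgue"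
    "\<And>x. x \<in> K \<Longrightarrow> \<bar>\<phi> x\<bar> \<le> C" "\<And>x. x \<notin> K \<Longrightarrow> \<phi> x = 0"
  shows "integrable lebesgue (\<lambda>x. \<phi> x *\<^sub>R f x)"
proof (rule Bochner_Integration.integrable_bound)
  show "integrable lebesgue (\<lambda>x. C *\<^sub>R (indicator K x *\<^sub>R f x))"
    by (intro integrable_scaleR_right locally_Lp_1_integrable assms)
  show "(\<lambda>x. \<phi> x *\<^sub>R f x) \<in> borel_measurable lebesgue"
    using assms(1,3) by (intro borel_measurable_scaleR) (auto simp: locally_Lp_def)
  have "norm (\<phi> x *\<^sub>R f x) \<le> norm (C *\<^sub>R (indicator K x *\<^sub>R f x))" for x
    using assms(4,5)[of x] by (cases "x \<in> K") (auto intro!: mult_right_mono)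
  then show "AE x in lebesgue. norm (\<phi> x *\<^sub>R f x) \<le> norm (C *\<^sub>R (indicator K x *\<^sub>R f x))"
    by simp
qed

lemma test_function_measurable: "test_function \<phi> \<Longrightarrow> \<phi> \<in> borel_measurable lebesgue"
  using borel_measurable_continuous_onI[OF test_function_continuous]
  by (intro measurable_completion) simp

lemma test_function_integrable_scaleR:
  assumes "test_function \<phi>" "locally_Lp 1 f"
  shows "integrable lebesgue (\<lambda>x. \<phi> x *\<^sub>R f x)"
proof -
  obtain R C where "0 < R" "0 \<le> C" "\<And>x. R \<le> norm x \<Longrightarrow> \<phi> x = 0" "\<And>x. \<bar>\<phi> x\<bar> \<le> C"
    using test_function_bounds[OF assms(1)] by blast
  then show ?thesis
    by (intro locally_Lp_1_integrable_scaleR[where K="cball 0 R" and C=C]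
        test_function_measurable assms) auto
qed

lemma locally_Lp_1_diff:
  assumes "locally_Lp 1 f" "locally_Lp 1 g"
  shows "locally_Lp 1 (\<lambda>x. f x - g x)"
proof -
  have "set_integrable lebesgue K (\<lambda>x. norm (f x - g x) ^ 1)" if K: "compact K" for K
  proof -
    have "integrable lebesgue (\<lambda>x. norm (indicator K x *\<^sub>R f x - indicator K x *\<^sub>R g x))"
      using assms K by (intro integrable_norm Bochner_Integration.integrable_diff locally_Lp_1_integrable)
    then show ?thesis by (simp add: set_integrable_def flip: scaleR_diff_right)
  qed
  then show ?thesis using assms by (auto simp: locally_Lp_def)
qed

text \<open>A countable cover by Borel sets of finite measure serves for the completion too; the
  passage from vanishing integrals over sets to a vanishing density relies on it.\<close>

lemma sigma_finite_lebesgue: "sigma_finite_measure (lebesgue :: 'a::euclidean_space measure)"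
proof
  obtain A :: "'a set set" where A: "countable A" "A \<subseteq> sets lborel" "\<Union>A = space lborel"
    "\<forall>a\<in>A. emeasure lborel a \<noteq> \<infinity>"
    using sigma_finite_measure.sigma_finite_countable[OF sigma_finite_lborel] by blast
  then have "A \<subseteq> sets lebesgue" "\<Union>A = space lebesgue" "\<forall>a\<in>A. emeasure lebesgue a \<noteq> \<infinity>"
    by auto
  with A(1) show "\<exists>A::'a set set. countable A \<and> A \<subseteq> sets lebesgue \<and> \<Union>A = space lebesgue \<and>
      (\<forall>a\<in>A. emeasure lebesgue a \<noteq> \<infinity>)"
    by blast
qed

text \<open>The box bumps converge boundedly to the indicator functions of boxes, which generate
  the Borel sets.\<close>

lemma AE_eq_0_of_box_bumps:
  fixes g :: "'a::euclidean_space \<Rightarrow> 'b::euclidean_space"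
  assumes U: "open U" and g: "locally_Lp 1 g"
    and bump: "\<And>a b n. cbox a b \<subseteq> U \<Longrightarrow> (\<integral>x. box_bump a b n x *\<^sub>R g x \<partial>lebesgue) = 0"
  shows "AE x in lebesgue. x \<in> U \<longrightarrow> g x = 0"
proof -
  have box0: "(\<integral>x. indicator (box a b) x *\<^sub>R g x \<partial>lebesgue) = 0" if ab: "cbox a b \<subseteq> U" for a b
  proof -
    have "(\<lambda>n. \<integral>x. box_bump a b n x *\<^sub>R g x \<partial>lebesgue)
        \<longlonglongrightarrow> (\<integral>x. indicator (box a b) x *\<^sub>R g x \<partial>lebesgue)"
    proof (rule integral_dominated_convergence)
      show "(\<lambda>x. indicator (box a b) x *\<^sub>R g x) \<in> borel_measurable lebesgue"
        using g by (intro borel_measurable_scaleR borel_measurable_indicator) (auto simp: locally_Lp_def)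
      show "(\<lambda>x. box_bump a b n x *\<^sub>R g x) \<in> borel_measurable lebesgue" for n
        using test_function_integrable_scaleR[OF test_function_box_bump g]
        by (rule borel_measurable_integrable)
      show "integrable lebesgue (\<lambda>x. norm (indicator (cbox a b) x *\<^sub>R g x))"
        by (intro integrable_norm locally_Lp_1_integrable g compact_cbox)
      show "AE x in lebesgue. (\<lambda>n. box_bump a b n x *\<^sub>R g x) \<longlonglongrightarrow> indicator (box a b) x *\<^sub>R g x"
        by (intro AE_I2 tendsto_scaleR box_bump_tendsto tendsto_const)
      show "AE x in lebesgue. norm (box_bump a b n x *\<^sub>R g x) \<le> norm (indicator (cbox a b) x *\<^sub>R g x)" for n
      proof (rule AE_I2)
        fix x
        show "norm (box_bump a b n x *\<^sub>R g x) \<le> norm (indicator (cbox a b) x *\<^sub>R g x)"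
          using box_bump_bounds[of a b n x] box_bump_eq_0[of x a b n] box_subset_cbox[of a b]
          by (cases "x \<in> box a b") (auto intro!: mult_left_le_one_le simp: subset_iff)
      qed
    qed
    then show ?thesis using bump[OF ab] by (simp add: LIMSEQ_const_iff)
  qed
  have ae_cbox: "AE x in lebesgue. x \<in> cbox p q \<longrightarrow> g x = 0" if pq: "cbox p q \<subseteq> U" for p q
  proof -
    \<comment> \<open>Truncation to a box makes \<open>G\<close> integrable on the whole space, so
      that complements can be handled in the induction over the generated sigma-algebra.\<close>
    define G where "G x = indicator (box p q) x *\<^sub>R g x" for x
    have G: "integrable lebesgue G"
      unfolding G_def
    proof (rule locally_Lp_1_integrable_scaleR[OF g compact_cbox[of p q], where C=1])
      show "indicat_real (box p q) \<in> borel_measurable lebesgue" by (intro borel_measurable_indicator) auto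
    qed (use box_subset_cbox[of p q] in \<open>auto simp: indicator_def\<close>)
    have GI: "set_integrable lebesgue A G" if "A \<in> sets lebesgue" for A
      unfolding set_integrable_def by (rule integrable_mult_indicator[OF that G])
    have int_box: "set_lebesgue_integral lebesgue (box a b) G = 0" for a b
    proof -
      \<comment> \<open>The corners of the intersection of the two boxes, taken
        coordinatewise.\<close>
      define a' b' where "a' = (\<Sum>i\<in>Basis. max (a\<bullet>i) (p\<bullet>i) *\<^sub>R i)"
        and "b' = (\<Sum>i\<in>Basis. min (b\<bullet>i) (q\<bullet>i) *\<^sub>R i)"
      have "box a b \<inter> box p q = box a' b'" "cbox a b \<inter> cbox p q = cbox a' b'"
        by (simp_all add: a'_def b'_def box_Int_box Int_interval)
      moreover from this have "(\<integral>x. indicator (box a' b') x *\<^sub>R g x \<partial>lebesgue) = 0"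
        using pq by (intro box0) blast
      moreover have "indicator (box a b) x *\<^sub>R G x = indicator (box a b \<inter> box p q) x *\<^sub>R g x" for x
        by (simp add: G_def indicator_def)
      ultimately show ?thesis by (simp add: set_lebesgue_integral_def)
    qed
    have int_UNIV: "integral\<^sup>L lebesgue G = 0"
      using box0[OF pq] unfolding G_def .
    have int_borel: "set_lebesgue_integral lebesgue A G = 0" if "A \<in> sets borel" for A
    proof -
      have "A \<in> sigma_sets UNIV (range (\<lambda>(a, b). box a b :: 'a set))"
        using that by (simp add: borel_eq_box)
      have meas: "B \<in> sets lebesgue" if "B \<in> sigma_sets UNIV (range (\<lambda>(a, b). box a b :: 'a set))" for B
      proof -
        have "B \<in> sets borel" using that by (simp add: borel_eq_box)
        then show ?thesis by auto
      qed
      have stable: "Int_stable (range (\<lambda>(a, b). box a b :: 'a set))"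
        by (auto simp: Int_stable_def box_Int_box)
      have pow: "range (\<lambda>(a, b). box a b :: 'a set) \<subseteq> Pow UNIV" by simp
      show ?thesis
        using stable pow \<open>A \<in> sigma_sets UNIV (range (\<lambda>(a, b). box a b))\<close>
      proof (induction rule: sigma_sets_induct_disjoint)
        case (basic A)
        then show ?case by (auto simp: int_box)
      next
        case empty
        then show ?case by (simp add: set_lebesgue_integral_def)
      next
        case (compl A)
        have "indicator (UNIV - A) x *\<^sub>R G x = G x - indicator A x *\<^sub>R G x" for x
          by (simp add: indicator_def)
        then show ?case
          using compl.IH int_UNIV GI[OF meas[OF compl.hyps]] G
          by (simp add: set_lebesgue_integral_def set_integrable_def)
      next
        case (union A)
        have "set_lebesgue_integral lebesgue (\<Union>i. A i) G = (\<Sum>i. set_lebesgue_integral lebesgue (A i) G)"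
        proof (rule lebesgue_integral_countable_add)
          show "A i \<in> sets lebesgue" for i using union by (intro meas) auto
          then show "set_integrable lebesgue (\<Union>i. A i) G" by (intro GI) auto
          show "A i \<inter> A j = {}" if "i \<noteq> j" for i j
            using union(1) that by (auto simp: disjoint_family_on_def)
        qed
        then show ?case using union.IH by simp
      qed
    qed
    \<comment> \<open>A Lebesgue set differs from a Borel set by a null set, so the Borel case
      suffices.\<close>
    have int_0: "set_lebesgue_integral lebesgue A G = 0" if A: "A \<in> sets lebesgue" for A
    proof -
      obtain S N N' where S: "A = S \<union> N" "N \<subseteq> N'" "N' \<in> null_sets lborel" "S \<in> sets lborel"
        using A by (rule sets_completionE)
      have "AE x in lborel. x \<notin> N'" using S(3) by (rule AE_not_in)
      then have "AE x in lebesgue. x \<notin> N'" by (rule AE_completion)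
      then have "AE x in lebesgue. x \<in> S \<longleftrightarrow> x \<in> A"
        by eventually_elim (use S in auto)
      moreover have "S \<in> sets lebesgue" using S(4) by auto
      ultimately have "set_lebesgue_integral lebesgue A G = set_lebesgue_integral lebesgue S G"
        using GI A by (intro set_integral_cong_set) (auto simp: set_borel_measurable_def set_integrable_def)
      then show ?thesis using int_borel S(4) by simp
    qed
    have "AE x in lebesgue. G x = 0" by (rule sigma_finite_measure.density_zero[OF sigma_finite_lebesgue G int_0])
    \<comment> \<open>\<open>G\<close> sees the open box only; the faces of the closed one form a
      null set.\<close>
    moreover have "AE x in lebesgue. x \<notin> cbox p q - box p q"
      using negligible_frontier_interval by (intro AE_not_in) (simp add: negligible_iff_null_sets)
    ultimately show ?thesis
      by eventually_elim (auto simp: G_def indicator_def split: if_splits)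
  qed
  obtain D where D: "countable D" "\<And>X. X \<in> D \<Longrightarrow> \<exists>a b. X = cbox a b" "\<Union>D = U"
    using open_countable_Union_open_cbox[OF U] by metis
  have "AE x in lebesgue. \<forall>X\<in>D. x \<in> X \<longrightarrow> g x = 0"
    unfolding AE_ball_countable[OF D(1)]
  proof
    fix X assume X: "X \<in> D"
    then obtain a b where "X = cbox a b" using D(2) by blast
    moreover have "X \<subseteq> U" using D(3) X by auto
    ultimately show "AE x in lebesgue. x \<in> X \<longrightarrow> g x = 0" using ae_cbox by simp
  qed
  then show ?thesis
    by eventually_elim (use D(3) in auto)
qed

section \<open>Weak partial derivatives: differences, locality, uniqueness\<close>

lemma has_weak_partial_diff:
  assumes "has_weak_partial u e g" "has_weak_partial v e h" "e \<in> Basis"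
  shows "has_weak_partial (\<lambda>x. u x - v x) e (\<lambda>x. g x - h x)"
  using assms
  by (auto simp: has_weak_partial_def locally_Lp_1_diff scaleR_diff_right
      Bochner_Integration.integral_diff test_function_integrable_scaleR test_function_derivative
      simp del: One_nat_def)

text \<open>Locality: a bump supported in a closed box inside \<open>U\<close> has its derivative
  supported there as well, where \<open>w\<close> vanishes almost everywhere. The weak identity then
  makes every bump integral of \<open>g\<close> vanish.\<close>

lemma has_weak_partial_eq_0:
  assumes "open U" "has_weak_partial w e g" "AE x in lebesgue. x \<in> U \<longrightarrow> w x = 0"
  shows "AE x in lebesgue. x \<in> U \<longrightarrow> g x = 0"
proof (rule AE_eq_0_of_box_bumps[OF assms(1)])
  show "locally_Lp 1 g" using assms(2) by (simp add: has_weak_partial_def)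
  fix a b n assume ab: "cbox a b \<subseteq> U"
  have "AE x in lebesgue. frechet_derivative (box_bump a b n) (at x) e *\<^sub>R w x = 0"
    using assms(3)
  proof eventually_elim
    case (elim x)
    show ?case
    proof (cases "x \<in> U")
      case False
      have "box_bump a b n y = 0" if "y \<notin> cbox a b" for y
        using that box_subset_cbox[of a b] by (intro box_bump_eq_0) auto
      with False have "frechet_derivative (box_bump a b n) (at x) = (\<lambda>h. 0)"
        using ab by (intro frechet_derivative_eq_0_outside[of "cbox a b"]) auto
      then show ?thesis by simp
    qed (use elim in simp)
  qed
  then have "(\<integral>x. frechet_derivative (box_bump a b n) (at x) e *\<^sub>R w x \<partial>lebesgue) = 0"
    by (rule integral_eq_zero_AE)
  then show "(\<integral>x. box_bump a b n x *\<^sub>R g x \<partial>lebesgue) = 0"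
    using assms(2) test_function_box_bump[of a b n] by (simp add: has_weak_partial_def)
qed

lemma has_weak_partial_unique:
  assumes "has_weak_partial u e g" "has_weak_partial u e h" "e \<in> Basis"
  shows "AE x in lebesgue. g x = h x"
  using has_weak_partial_eq_0[OF open_UNIV has_weak_partial_diff[OF assms]] by simp

lemma has_weak_partial_weak_partial:
  "has_weak_partial u e g \<Longrightarrow> has_weak_partial u e (weak_partial u e)"
  unfolding weak_partial_def by (rule someI[where P="has_weak_partial u e"])

section \<open>Difference quotients and integrals of directional derivatives\<close>

lemma has_derivative_line:
  assumes "(f has_derivative D) (at x)"
  shows "((\<lambda>t. f (x + t *\<^sub>R e)) has_vector_derivative D e) (at (0::real))"
proof -
  have D: "(f has_derivative D) (at (x + 0 *\<^sub>R e))" using assms by simp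
  have "((\<lambda>t. x + t *\<^sub>R e) has_derivative (\<lambda>t. t *\<^sub>R e)) (at 0)"
    by (auto intro!: derivative_eq_intros)
  from has_derivative_compose[OF this D]
  show ?thesis
    by (simp add: has_vector_derivative_def linear_scale[OF has_derivative_linear[OF assms]])
qed

lemma has_derivative_imp_quotient_tendsto:
  assumes "(f has_derivative D) (at x)"
  shows "((\<lambda>t. (f (x + t *\<^sub>R e) - f x) /\<^sub>R t) \<longlongrightarrow> D e) (at (0::real))"
proof -
  have "((\<lambda>t. norm ((f (x + t *\<^sub>R e) - f x) - t *\<^sub>R D e) / norm t) \<longlongrightarrow> 0) (at 0)"
    using has_derivative_line[OF assms, of e]
    unfolding has_vector_derivative_def has_derivative_iff_norm by simp
  then have "((\<lambda>t. norm ((f (x + t *\<^sub>R e) - f x) /\<^sub>R t - D e)) \<longlongrightarrow> 0) (at 0)"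
  proof (rule Lim_transform_eventually)
    have "norm ((f (x + t *\<^sub>R e) - f x) - t *\<^sub>R D e) / norm t
      = norm ((f (x + t *\<^sub>R e) - f x) /\<^sub>R t - D e)" if "t \<noteq> 0" for t
    proof -
      have "(f (x + t *\<^sub>R e) - f x) /\<^sub>R t - D e = ((f (x + t *\<^sub>R e) - f x) - t *\<^sub>R D e) /\<^sub>R t"
        using that by (simp add: algebra_simps)
      then show ?thesis by (simp add: divide_inverse mult.commute)
    qed
    then show "\<forall>\<^sub>F t in at 0. norm ((f (x + t *\<^sub>R e) - f x) - t *\<^sub>R D e) / norm t
      = norm ((f (x + t *\<^sub>R e) - f x) /\<^sub>R t - D e)"
      by (auto simp: eventually_at_filter)
  qed
  then show ?thesis by (simp add: tendsto_norm_zero_iff LIM_zero_iff)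
qed

text \<open>Difference quotients have integral 0 by translation invariance of the Lebesgue measure.\<close>

lemma integral_directional_derivative_eq_0:
  fixes F G :: "'a::euclidean_space \<Rightarrow> 'b::euclidean_space"
  assumes cont: "continuous_on UNIV F" and supp: "\<And>x. R \<le> norm x \<Longrightarrow> F x = 0"
    and lip: "\<And>x t. \<bar>t\<bar> \<le> 1 \<Longrightarrow> norm (F (x + t *\<^sub>R e) - F x) \<le> C * \<bar>t\<bar>"
    and lim: "AE x in lebesgue. ((\<lambda>t. (F (x + t *\<^sub>R e) - F x) /\<^sub>R t) \<longlongrightarrow> G x) (at 0)"
    and meas: "G \<in> borel_measurable lebesgue"
  shows "(\<integral>x. G x \<partial>lebesgue) = 0"
proof -
  \<comment> \<open>Steps 1/(n + 1) are nonzero and at most 1, the range in which \<open>lip\<close>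
    bounds the increments.\<close>
  define h where "h n = inverse (real (Suc n))" for n
  have h: "h n \<noteq> 0" "\<bar>h n\<bar> \<le> 1" for n by (auto simp: h_def inverse_le_1_iff)
  have h0: "filterlim h (at 0) sequentially"
    using LIMSEQ_inverse_real_of_nat h by (auto simp: filterlim_at h_def[abs_def])
  have Fm: "F \<in> borel_measurable borel" by (rule borel_measurable_continuous_onI[OF cont])
  have "integrable lborel (\<lambda>x. indicator (cball 0 R) x *\<^sub>R F x)"
    by (rule borel_integrable_compact) (auto intro: continuous_on_subset[OF cont])
  moreover have "indicator (cball 0 R) x *\<^sub>R F x = F x" for x
    using supp[of x] by (auto simp: indicator_def)
  ultimately have FI: "integrable lborel F" by simp
  have shift_int: "integrable lborel (\<lambda>x. F (x + c))" and shift: "(\<integral>x. F (x + c) \<partial>lborel) = (\<integral>x. F x \<partial>lborel)" for c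
    using integrable_distr_eq[of "(+) c" lborel borel F] integral_distr[of "(+) c" lborel borel F]
      lborel_distr_plus[of c] FI Fm by (simp_all add: add.commute)
  define s where "s n x = (F (x + h n *\<^sub>R e) - F x) /\<^sub>R h n" for n x
  have sm: "s n \<in> borel_measurable borel" for n
    unfolding s_def[abs_def]
    by (intro borel_measurable_continuous_onI continuous_intros continuous_on_compose2[OF cont]) auto
  have s0: "integral\<^sup>L lebesgue (s n) = 0" for n
  proof -
    have "integral\<^sup>L lebesgue (s n) = integral\<^sup>L lborel (s n)"
      by (rule integral_completion) (use sm in simp)
    also have "\<dots> = 0"
      unfolding s_def using shift_int[of "h n *\<^sub>R e"] shift[of "h n *\<^sub>R e"] FI by simp
    finally show ?thesis .
  qed
  have "(\<lambda>n. integral\<^sup>L lebesgue (s n)) \<longlonglongrightarrow> integral\<^sup>L lebesgue G"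
  proof (rule integral_dominated_convergence[OF meas])
    show "s n \<in> borel_measurable lebesgue" for n
      using sm by (intro measurable_completion) simp
    \<comment> \<open>A shift by at most \<open>norm e\<close> enlarges the support of the
      difference quotients to this ball; the Lipschitz bound dominates them there by the constant
      \<open>C\<close>.\<close>
    show "integrable lebesgue (\<lambda>x. C * indicator (cball 0 (R + norm e)) x)"
      by (intro integrable_mult_right integrable_real_indicator)
        (use emeasure_lborel_cball_finite in auto)
    show "AE x in lebesgue. (\<lambda>n. s n x) \<longlonglongrightarrow> G x"
      using lim by eventually_elim (auto simp: s_def intro: filterlim_compose[OF _ h0])
    fix n
    have "norm (s n x) \<le> C * indicator (cball 0 (R + norm e)) x" for x
    proof (cases "norm x \<le> R + norm e")
      case True
      have "norm (s n x) = norm (F (x + h n *\<^sub>R e) - F x) / \<bar>h n\<bar>"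
        by (simp add: s_def divide_inverse mult.commute)
      also have "\<dots> \<le> C" using lip[of "h n" x] h[of n] by (simp add: divide_le_eq)
      finally show ?thesis using True by simp
    next
      case False
      have "norm (h n *\<^sub>R e) \<le> norm e" using h[of n] by (simp add: mult_left_le_one_le)
      then have "R \<le> norm (x + h n *\<^sub>R e)"
        using False norm_triangle_ineq2[of x "- (h n *\<^sub>R e)"] by simp
      moreover have "R \<le> norm x" using False norm_ge_zero[of e] by linarith
      ultimately show ?thesis using False supp by (simp add: s_def)
    qed
    then show "AE x in lebesgue. norm (s n x) \<le> C * indicator (cball 0 (R + norm e)) x" by simp
  qed
  then show ?thesis by (simp add: s0 LIMSEQ_const_iff)
qed

section \<open>Weak derivatives of Lipschitz functions\<close>

lemma locally_Lp_AE_bounded: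
  fixes f :: "'a::euclidean_space \<Rightarrow> 'b::euclidean_space"
  assumes "f \<in> borel_measurable lebesgue" "AE x in lebesgue. norm (f x) \<le> C"
  shows "locally_Lp p f"
proof -
  have "set_integrable lebesgue K (\<lambda>x. norm (f x) ^ p)" if K: "compact K" for K
    unfolding set_integrable_def
  proof (rule Bochner_Integration.integrable_bound)
    have Kl: "K \<in> lmeasurable" using K by (rule lmeasurable_compact)
    then show "integrable lebesgue (\<lambda>x. C ^ p * indicator K x)"
      by (intro integrable_mult_right integrable_real_indicator) (auto simp: fmeasurable_def)
    show "(\<lambda>x. indicator K x *\<^sub>R norm (f x) ^ p) \<in> borel_measurable lebesgue"
      using Kl assms(1) by (intro borel_measurable_scaleR borel_measurable_indicator
          borel_measurable_power borel_measurable_norm) auto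
    show "AE x in lebesgue. norm (indicator K x *\<^sub>R norm (f x) ^ p) \<le> norm (C ^ p * indicator K x)"
      using assms(2)
    proof eventually_elim
      case (elim x)
      then have "norm (f x) ^ p \<le> \<bar>C ^ p\<bar>"
        by (metis abs_ge_self norm_ge_zero order_trans power_mono)
      then show ?case by (simp add: indicator_def)
    qed
  qed
  then show ?thesis using assms(1) by (simp add: locally_Lp_def)
qed

lemma locally_Lp_continuous:
  fixes f :: "'a::euclidean_space \<Rightarrow> 'b::euclidean_space"
  assumes "continuous_on UNIV f"
  shows "locally_Lp p f"
proof -
  have "set_integrable lebesgue K (\<lambda>x. norm (f x) ^ p)" if K: "compact K" for K
  proof -
    have "integrable lborel (\<lambda>x. indicator K x *\<^sub>R norm (f x) ^ p)"
      by (rule borel_integrable_compact[OF K])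
        (intro continuous_intros continuous_on_subset[OF assms], simp)
    then show ?thesis
      unfolding set_integrable_def by (simp add: integrable_completion borel_measurable_integrable)
  qed
  moreover have "f \<in> borel_measurable lebesgue"
    using borel_measurable_continuous_onI[OF assms] by (intro measurable_completion) simp
  ultimately show ?thesis by (simp add: locally_Lp_def)
qed

lemma test_function_lipschitz_line:
  assumes "test_function \<phi>" "\<And>y. \<bar>frechet_derivative \<phi> (at y) e\<bar> \<le> C"
  shows "\<bar>\<phi> (x + t *\<^sub>R e) - \<phi> x\<bar> \<le> C * \<bar>t\<bar>"
proof -
  have "((\<lambda>t. \<phi> (x + t *\<^sub>R e)) has_field_derivative frechet_derivative \<phi> (at (x + s *\<^sub>R e)) e) (at s)"
    for s
  proof -
    have "((\<lambda>t. \<phi> (x + s *\<^sub>R e + t *\<^sub>R e)) has_vector_derivative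
        frechet_derivative \<phi> (at (x + s *\<^sub>R e)) e) (at 0)"
      by (rule has_derivative_line[OF test_function_has_derivative[OF assms(1)]])
    then have "((\<lambda>t. \<phi> (x + (t + s) *\<^sub>R e)) has_field_derivative
        frechet_derivative \<phi> (at (x + s *\<^sub>R e)) e) (at 0)"
      by (simp add: has_real_derivative_iff_has_vector_derivative algebra_simps)
    then show ?thesis
      using DERIV_shift[of "\<lambda>t. \<phi> (x + t *\<^sub>R e)" _ 0 s] by simp
  qed
  then have "norm (\<phi> (x + t *\<^sub>R e) - \<phi> (x + 0 *\<^sub>R e)) \<le> C * norm (t - 0)"
    using assms(2) by (intro field_differentiable_bound[of UNIV]) auto
  then show ?thesis by simp
qed

lemma has_derivative_norm_le_lipschitz:
  assumes "L-lipschitz_on UNIV u" "(u has_derivative D) (at x)"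
  shows "norm (D e) \<le> L * norm e"
proof (rule Lim_norm_ubound)
  show "((\<lambda>t. (u (x + t *\<^sub>R e) - u x) /\<^sub>R t) \<longlongrightarrow> D e) (at (0::real))"
    by (rule has_derivative_imp_quotient_tendsto[OF assms(2)])
  have "norm ((u (x + t *\<^sub>R e) - u x) /\<^sub>R t) \<le> L * norm e" if "t \<noteq> 0" for t
    using lipschitz_on_normD[OF assms(1), of "x + t *\<^sub>R e" x] that
    by (simp add: divide_simps mult.commute mult.left_commute)
  then show "\<forall>\<^sub>F t in at 0. norm ((u (x + t *\<^sub>R e) - u x) /\<^sub>R t) \<le> L * norm e"
    by (auto simp: eventually_at_filter)
qed simp

text \<open>Integration by parts is the vanishing of the integral of the directional derivative of
  \<phi> u. The Lipschitz bound dominates the difference quotients, so differentiability almost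
  everywhere is enough and a kink along a circle does no harm.\<close>

lemma has_weak_partial_lipschitz:
  fixes u :: "'a::euclidean_space \<Rightarrow> 'b::euclidean_space"
  assumes lip: "L-lipschitz_on UNIV u" and e: "e \<in> Basis"
    and der: "AE x in lebesgue. (u has_derivative D x) (at x)"
    and meas: "(\<lambda>x. D x e) \<in> borel_measurable lebesgue"
  shows "has_weak_partial u e (\<lambda>x. D x e)" "locally_Lp p (\<lambda>x. D x e)"
proof -
  have cont: "continuous_on UNIV u" by (rule lipschitz_on_continuous_on[OF lip])
  have ne: "norm e = 1" using e by simp
  have bd: "AE x in lebesgue. norm (D x e) \<le> L"
    using der
  proof eventually_elim
    case (elim x)
    then show ?case using has_derivative_norm_le_lipschitz[OF lip, of "D x" x e] ne by simp
  qed
  show Lp: "locally_Lp p (\<lambda>x. D x e)" for p by (rule locally_Lp_AE_bounded[OF meas bd])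
  have u1: "locally_Lp 1 u" by (rule locally_Lp_continuous[OF cont])
  have "(\<integral>x. frechet_derivative \<phi> (at x) e *\<^sub>R u x \<partial>lebesgue) = - (\<integral>x. \<phi> x *\<^sub>R D x e \<partial>lebesgue)"
    if \<phi>: "test_function \<phi>" for \<phi>
  proof -
    note d\<phi> = test_function_derivative[OF \<phi> e]
    obtain R C where R: "0 < R" "0 \<le> C" "\<And>x. R \<le> norm x \<Longrightarrow> \<phi> x = 0" "\<And>x. \<bar>\<phi> x\<bar> \<le> C"
      using test_function_bounds[OF \<phi>] by blast
    obtain R' C' where "0 < R'" and C': "0 \<le> C'"
        and "\<And>x. R' \<le> norm x \<Longrightarrow> frechet_derivative \<phi> (at x) e = 0"
        and dC': "\<And>x. \<bar>frechet_derivative \<phi> (at x) e\<bar> \<le> C'"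
      using test_function_bounds[OF d\<phi>] by blast
    \<comment> \<open>Outside this ball both \<open>x\<close> and \<open>x + t *\<^sub>R e\<close>
      miss the support of \<phi>, as |t| \<le> 1 and \<open>e\<close> is a unit vector. A bound for
      \<open>u\<close> on the ball therefore suffices.\<close>
    have "bounded (u ` cball 0 (R + 1))"
      by (intro compact_imp_bounded compact_continuous_image continuous_on_subset[OF cont]) auto
    then obtain M where "\<forall>x\<in>u ` cball 0 (R + 1). norm x \<le> M"
      unfolding bounded_iff by blast
    then have M: "norm (u x) \<le> M" if "norm x \<le> R + 1" for x using that by simp
    let ?G = "\<lambda>x. \<phi> x *\<^sub>R D x e + frechet_derivative \<phi> (at x) e *\<^sub>R u x"
    have I1: "integrable lebesgue (\<lambda>x. \<phi> x *\<^sub>R D x e)"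
      by (rule test_function_integrable_scaleR[OF \<phi> Lp])
    have I2: "integrable lebesgue (\<lambda>x. frechet_derivative \<phi> (at x) e *\<^sub>R u x)"
      by (rule test_function_integrable_scaleR[OF d\<phi> u1])
    have "(\<integral>x. ?G x \<partial>lebesgue) = 0"
    proof (rule integral_directional_derivative_eq_0)
      show "continuous_on UNIV (\<lambda>x. \<phi> x *\<^sub>R u x)"
        by (intro continuous_intros test_function_continuous[OF \<phi>] cont)
      show "\<phi> x *\<^sub>R u x = 0" if "R \<le> norm x" for x using R(3)[OF that] by simp
      show "?G \<in> borel_measurable lebesgue"
        using I1 I2 by (intro borel_measurable_add borel_measurable_integrable)
      show "AE x in lebesgue.
          ((\<lambda>t. (\<phi> (x + t *\<^sub>R e) *\<^sub>R u (x + t *\<^sub>R e) - \<phi> x *\<^sub>R u x) /\<^sub>R t) \<longlongrightarrow> ?G x) (at 0)"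
        using der
      proof eventually_elim
        case (elim x)
        show ?case
          by (rule has_derivative_imp_quotient_tendsto[OF
                has_derivative_scaleR[OF test_function_has_derivative[OF \<phi>] elim]])
      qed
      fix x and t :: real assume t: "\<bar>t\<bar> \<le> 1"
      show "norm (\<phi> (x + t *\<^sub>R e) *\<^sub>R u (x + t *\<^sub>R e) - \<phi> x *\<^sub>R u x) \<le> (C * L + C' * M) * \<bar>t\<bar>"
      proof (cases "norm x \<le> R + 1")
        case True
        have 1: "norm (\<phi> (x + t *\<^sub>R e) *\<^sub>R (u (x + t *\<^sub>R e) - u x)) \<le> C * (L * \<bar>t\<bar>)"
          using R(4)[of "x + t *\<^sub>R e"] lipschitz_on_normD[OF lip, of "x + t *\<^sub>R e" x] ne R(2)
          by (auto intro!: mult_mono)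
        have 2: "norm ((\<phi> (x + t *\<^sub>R e) - \<phi> x) *\<^sub>R u x) \<le> (C' * \<bar>t\<bar>) * M"
          using test_function_lipschitz_line[OF \<phi> dC', of x t] M[OF True] C'
          by (auto intro!: mult_mono)
        \<comment> \<open>Discrete product rule, arranged so that \<open>u\<close> itself is
          evaluated only at the unshifted point, where the bound \<open>M\<close> applies.\<close>
        have "\<phi> (x + t *\<^sub>R e) *\<^sub>R u (x + t *\<^sub>R e) - \<phi> x *\<^sub>R u x
          = \<phi> (x + t *\<^sub>R e) *\<^sub>R (u (x + t *\<^sub>R e) - u x) + (\<phi> (x + t *\<^sub>R e) - \<phi> x) *\<^sub>R u x"
          by (simp add: algebra_simps)
        then show ?thesis
          using norm_triangle_le[OF add_mono[OF 1 2]] by (simp add: algebra_simps)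
      next
        case False
        then have "R \<le> norm (x + t *\<^sub>R e)"
          using norm_triangle_ineq2[of x "- (t *\<^sub>R e)"] ne t by simp
        moreover have "0 \<le> M" using order_trans[OF norm_ge_zero M[of 0]] R(1) by simp
        ultimately show ?thesis
          using False R(3) R(2) C' lipschitz_on_nonneg[OF lip] by simp
      qed
    qed
    then show ?thesis using I1 I2 by (simp add: eq_neg_iff_add_eq_0 add.commute)
  qed
  then show "has_weak_partial u e (\<lambda>x. D x e)"
    unfolding has_weak_partial_def using u1 Lp by blast
qed

text \<open>Testing with an antiderivative of a box bump in one coordinate.\<close>

lemma AE_eq_0_of_weak_partial_eq_0:
  fixes w :: "'a::euclidean_space \<Rightarrow> 'b::euclidean_space"
  assumes b: "b \<in> Basis" and w: "has_weak_partial w b g" and g: "AE x in lebesgue. g x = 0"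
    and supp: "AE x in lebesgue. l \<le> norm x \<longrightarrow> w x = 0"
  shows "AE x in lebesgue. w x = 0"
proof -
  have w1: "locally_Lp 1 w" using w by (simp add: has_weak_partial_def)
  have "AE x in lebesgue. x \<in> UNIV \<longrightarrow> w x = 0"
  proof (rule AE_eq_0_of_box_bumps[OF open_UNIV w1])
    fix p q :: 'a and n
    let ?h = "\<lambda>i. interval_bump (p \<bullet> i) (q \<bullet> i) n"
    \<comment> \<open>Antiderivative on the whole line of the factor in coordinate \<open>b\<close>.
      It need not have compact support, hence the cutoff that follows.\<close>
    have "\<exists>H. \<forall>t. - \<infinity> < ereal t \<longrightarrow> ereal t < \<infinity> \<longrightarrow> (H has_vector_derivative ?h b t) (at t)"
      using smooth_on_continuous[OF smooth_on_interval_bump]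
      by (intro einterval_antiderivative) (auto simp: continuous_on_eq_continuous_at)
    then obtain H where H: "\<And>t. (H has_field_derivative ?h b t) (at t)"
      by (auto simp: has_real_derivative_iff_has_vector_derivative)
    have Hs: "smooth_on UNIV H" by (rule smooth_onI_antiderivative[OF smooth_on_interval_bump H])
    \<comment> \<open>\<open>l\<close> has no sign here, hence the absolute value. The margin 1
      keeps \<eta> equal to 1 along short segments in direction \<open>b\<close> starting in the
      ball that carries \<open>w\<close>.\<close>
    obtain \<eta> :: "'a \<Rightarrow> real" where \<eta>: "smooth_on UNIV \<eta>" "\<And>x. norm x \<le> \<bar>l\<bar> + 1 \<Longrightarrow> \<eta> x = 1"
      "\<And>x. \<bar>l\<bar> + 2 \<le> norm x \<Longrightarrow> \<eta> x = 0"
      using exists_cutoff_function[of "\<bar>l\<bar> + 1" "\<bar>l\<bar> + 2"] by auto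
    let ?P = "\<lambda>x. \<Prod>i\<in>Basis - {b}. ?h i (x \<bullet> i)"
    \<comment> \<open>\<open>?P\<close> does not involve coordinate \<open>b\<close>, so on the ball
      that carries \<open>w\<close> differentiation along \<open>b\<close> turns \<open>H\<close>
      back into the bump and restores the full box bump. Testing \<open>w\<close> with this function
      then leaves only an integral against g = 0.\<close>
    let ?\<phi> = "\<lambda>x. \<eta> x * (H (x \<bullet> b) * ?P x)"
    have K: "smooth_on (ball 0 (\<bar>l\<bar> + 3)) (\<lambda>x. H (x \<bullet> b) * ?P x)"
    proof (rule smooth_on_mult)
      show "smooth_on (ball 0 (\<bar>l\<bar> + 3)) (\<lambda>x. H (x \<bullet> b))"
        by (rule smooth_on_compose[OF _ Hs smooth_on_linear[OF bounded_linear_inner_left]]) auto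
      show "smooth_on (ball 0 (\<bar>l\<bar> + 3)) ?P"
        by (rule smooth_on_prod[OF open_ball smooth_on_compose[OF open_ball smooth_on_interval_bump
              smooth_on_linear[OF bounded_linear_inner_left open_ball]]])
    qed simp
    have \<phi>: "test_function ?\<phi>"
      by (rule test_function_mult_cutoff[OF \<eta>(1,3) K]) auto
    have der: "frechet_derivative ?\<phi> (at x) b = box_bump p q n x" if x: "norm x < \<bar>l\<bar>" for x
    proof -
      have "((\<lambda>t. H (x \<bullet> b + t) * ?P x) has_field_derivative ?h b (x \<bullet> b) * ?P x) (at 0)"
        using H[of "x \<bullet> b"] DERIV_shift[of H _ 0 "x \<bullet> b"]
        by (intro DERIV_cmult_right) (simp add: add.commute)
      then have "((\<lambda>t. H (x \<bullet> b + t) * ?P x) has_vector_derivative ?h b (x \<bullet> b) * ?P x) (at 0)"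
        by (simp add: has_real_derivative_iff_has_vector_derivative)
      then have "((\<lambda>t. ?\<phi> (x + t *\<^sub>R b)) has_vector_derivative ?h b (x \<bullet> b) * ?P x) (at 0)"
      proof (rule has_vector_derivative_transform_within_open[where S="{-1<..<1}"])
        fix t :: real assume t: "t \<in> {-1<..<1}"
        have "norm (x + t *\<^sub>R b) \<le> \<bar>l\<bar> + 1"
          using norm_triangle_ineq[of x "t *\<^sub>R b"] x t b by auto
        then have "\<eta> (x + t *\<^sub>R b) = 1" by (rule \<eta>(2))
        moreover have "(x + t *\<^sub>R b) \<bullet> b = x \<bullet> b + t" using b by (simp add: inner_add_left)
        moreover have "?P (x + t *\<^sub>R b) = ?P x"
          using b by (intro prod.cong) (auto simp: inner_add_left inner_Basis)
        ultimately show "H (x \<bullet> b + t) * ?P x = ?\<phi> (x + t *\<^sub>R b)" by simp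
      qed auto
      moreover have "((\<lambda>t. ?\<phi> (x + t *\<^sub>R b)) has_vector_derivative frechet_derivative ?\<phi> (at x) b) (at 0)"
        by (rule has_derivative_line[OF test_function_has_derivative[OF \<phi>]])
      ultimately have "frechet_derivative ?\<phi> (at x) b = ?h b (x \<bullet> b) * ?P x"
        by (rule vector_derivative_unique_at[symmetric])
      also have "\<dots> = box_bump p q n x"
        by (simp add: box_bump_def prod.remove[OF finite_Basis b])
      finally show ?thesis .
    qed
    have "(\<integral>x. box_bump p q n x *\<^sub>R w x \<partial>lebesgue)
        = (\<integral>x. frechet_derivative ?\<phi> (at x) b *\<^sub>R w x \<partial>lebesgue)"
    proof (rule integral_cong_AE)
      show "AE x in lebesgue. box_bump p q n x *\<^sub>R w x = frechet_derivative ?\<phi> (at x) b *\<^sub>R w x"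
        using supp
      proof eventually_elim
        case (elim x)
        then show ?case by (cases "norm x < \<bar>l\<bar>") (simp_all only: der, auto)
      qed
    qed (intro borel_measurable_integrable test_function_integrable_scaleR w1
        test_function_box_bump test_function_derivative \<phi> b)+
    also have "\<dots> = - (\<integral>x. ?\<phi> x *\<^sub>R g x \<partial>lebesgue)"
      using w \<phi> unfolding has_weak_partial_def by blast
    also have "(\<integral>x. ?\<phi> x *\<^sub>R g x \<partial>lebesgue) = 0"
      using g by (intro integral_eq_zero_AE) (auto elim: eventually_mono)
    finally show "(\<integral>x. box_bump p q n x *\<^sub>R w x \<partial>lebesgue) = 0" by simp
  qed
  then show ?thesis by simp
qed

section \<open>The minimiser and its gradient\<close>

text \<open>A segment from the inside to the outside meets the sphere at some p; distances along it
  add up, so the two estimates through p combine with the same constant.\<close>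

lemma lipschitz_on_UNIV_glue_sphere:
  fixes f :: "'a::euclidean_space \<Rightarrow> 'b::metric_space"
  assumes inside: "L-lipschitz_on (cball 0 r) f" and outside: "L-lipschitz_on {x. r \<le> norm x} f"
  shows "L-lipschitz_on UNIV f"
proof (rule lipschitz_onI)
  show "0 \<le> L" by (rule lipschitz_on_nonneg[OF inside])
  have mixed: "dist (f x) (f y) \<le> L * dist x y" if "norm x \<le> r" "r \<le> norm y" for x y :: 'a
  proof -
    have "\<exists>t\<ge>0. t \<le> 1 \<and> norm (x + t *\<^sub>R (y - x)) = r"
      by (rule IVT') (use that in \<open>auto intro!: continuous_intros\<close>)
    then obtain t where t: "0 \<le> t" "t \<le> 1" "norm (x + t *\<^sub>R (y - x)) = r" by blast
    define p where "p = x + t *\<^sub>R (y - x)"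
    have "p = (1 - t) *\<^sub>R x + t *\<^sub>R y" by (simp add: p_def algebra_simps)
    then have "p \<in> closed_segment x y" using t by (auto simp: in_segment)
    then have seg: "dist x y = dist x p + dist p y" by (simp flip: between_mem_segment add: between)
    have "dist (f x) (f y) \<le> dist (f x) (f p) + dist (f p) (f y)" by (rule dist_triangle)
    also have "\<dots> \<le> L * dist x p + L * dist p y"
      using lipschitz_onD[OF inside, of x p] lipschitz_onD[OF outside, of p y] that t(3)
      by (intro add_mono) (auto simp: p_def)
    finally show ?thesis by (simp add: seg algebra_simps)
  qed
  fix x y :: 'a
  consider "norm x \<le> r" "norm y \<le> r" | "r \<le> norm x" "r \<le> norm y" | "norm x \<le> r" "r \<le> norm y"
    | "norm y \<le> r" "r \<le> norm x" by linarith
  then show "dist (f x) (f y) \<le> L * dist x y"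
  proof cases
    case 1
    then show ?thesis using lipschitz_onD[OF inside, of x y] by simp
  next
    case 2
    then show ?thesis using lipschitz_onD[OF outside, of x y] by simp
  next
    case 3
    then show ?thesis by (rule mixed)
  next
    case 4
    then show ?thesis using mixed[of y x] by (simp add: dist_commute)
  qed
qed

text \<open>The complex derivative of the inner branch acting by multiplication; the outer branch is
  antiholomorphic, hence the \<open>cnj\<close>. The circle, where no derivative is claimed, falls
  to the outer formula and is a null set.\<close>

definition u_deriv :: "real \<Rightarrow> complex \<Rightarrow> complex \<Rightarrow> complex \<Rightarrow> complex" where
  "u_deriv l z0 z h =
     (if z \<in> ball 0 l then 2 * (of_real l)\<^sup>2 / ((of_real l)\<^sup>2 - cnj z0 * z)\<^sup>2 * h
      else cnj (- 2 / (z - z0)\<^sup>2 * h))"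

context
  fixes l :: real and z0 :: complex
  assumes z0: "norm z0 < l"
begin

lemma radius_pos: "0 < l"
  using z0 norm_ge_zero[of z0] by linarith

lemma norm_denominator_in:
  assumes "norm z \<le> l"
  shows "l * (l - norm z0) \<le> norm ((of_real l)\<^sup>2 - cnj z0 * z)"
proof -
  have "norm (cnj z0 * z) \<le> norm z0 * l" using assms by (simp add: norm_mult mult_left_mono)
  moreover have "norm ((of_real l :: complex)\<^sup>2) = l\<^sup>2" by (simp add: norm_power)
  moreover have "norm ((of_real l)\<^sup>2 - cnj z0 * z) \<ge> norm ((of_real l :: complex)\<^sup>2) - norm (cnj z0 * z)"
    by (rule norm_triangle_ineq2)
  ultimately show ?thesis by (simp add: algebra_simps power2_eq_square)
qed

lemma norm_denominator_out: "l \<le> norm z \<Longrightarrow> l - norm z0 \<le> norm (z - z0)"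
  using norm_triangle_ineq2[of z z0] by simp

lemma denominator_in_nonzero: "norm z \<le> l \<Longrightarrow> (of_real l)\<^sup>2 - cnj z0 * z \<noteq> 0"
  using norm_denominator_in[of z] mult_pos_pos[OF radius_pos, of "l - norm z0"] z0 by auto

lemma denominator_out_nonzero: "l \<le> norm z \<Longrightarrow> z - z0 \<noteq> 0"
  using norm_denominator_out[of z] z0 by auto

lemma u_map_out: "l \<le> norm z \<Longrightarrow> u_map l z0 z = cnj (2 / (z - z0))"
  by (simp add: u_map_def)

text \<open>On the circle the two branches coincide, so each formula holds up to the circle on its
  own side. The Lipschitz gluing rests on this.\<close>

lemma u_map_in:
  assumes "norm z \<le> l"
  shows "u_map l z0 z = 2 * z / ((of_real l)\<^sup>2 - cnj z0 * z)"
proof (cases "norm z = l")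
  case True
  have "cnj z - cnj z0 \<noteq> 0" using denominator_out_nonzero[of z] True by (metis complex_cnj_diff complex_cnj_zero_iff order_refl)
  moreover have "(of_real l)\<^sup>2 = z * cnj z" using True by (metis complex_norm_square of_real_power)
  moreover have "z \<noteq> 0" using True radius_pos by auto
  ultimately have "2 / (cnj z - cnj z0) = 2 * z / ((of_real l)\<^sup>2 - cnj z0 * z)"
    by (simp add: divide_simps algebra_simps)
  then show ?thesis using True by (simp add: u_map_def)
qed (use assms in \<open>simp add: u_map_def\<close>)

text \<open>Both branches are fractional linear up to conjugation, so their differences factor
  exactly. Inside, the numerator 2 l^2 cancels against the bound l (l - |z0|) for each denominator,
  which yields the same constant as outside.\<close>

lemma lipschitz_on_u_map: "(2 / (l - norm z0)\<^sup>2)-lipschitz_on UNIV (u_map l z0)"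
proof (rule lipschitz_on_UNIV_glue_sphere[where r=l])
  let ?L = "2 / (l - norm z0)\<^sup>2"
  let ?d = "\<lambda>z. (of_real l)\<^sup>2 - cnj z0 * z"
  have pos: "0 < l - norm z0" using z0 by simp
  show "?L-lipschitz_on (cball 0 l) (u_map l z0)"
  proof (rule lipschitz_onI)
    fix z w :: complex assume zw: "z \<in> cball 0 l" "w \<in> cball 0 l"
    have nz: "?d z \<noteq> 0" "?d w \<noteq> 0" using zw denominator_in_nonzero by auto
    have "u_map l z0 z - u_map l z0 w = 2 * (of_real l)\<^sup>2 * (z - w) / (?d z * ?d w)"
      using zw nz by (simp add: u_map_in field_simps)
    then have "dist (u_map l z0 z) (u_map l z0 w) = 2 * l\<^sup>2 * dist z w / (norm (?d z) * norm (?d w))"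
      by (simp add: dist_norm norm_mult norm_divide norm_power)
    also have "\<dots> \<le> 2 * l\<^sup>2 * dist z w / ((l * (l - norm z0)) * (l * (l - norm z0)))"
      using pos radius_pos zw nz
      by (intro divide_left_mono mult_mono mult_pos_pos norm_denominator_in) auto
    also have "\<dots> = ?L * dist z w"
    proof -
      have "2 * l\<^sup>2 * D / ((l * d) * (l * d)) = 2 / d\<^sup>2 * D" if "d \<noteq> 0" for d D :: real
        using radius_pos that by (simp add: field_simps power2_eq_square)
      then show ?thesis using pos by simp
    qed
    finally show "dist (u_map l z0 z) (u_map l z0 w) \<le> ?L * dist z w" .
  qed simp
  show "?L-lipschitz_on {z. l \<le> norm z} (u_map l z0)"
  proof (rule lipschitz_onI)
    fix z w :: complex assume zw: "z \<in> {z. l \<le> norm z}" "w \<in> {z. l \<le> norm z}"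
    have nz: "z - z0 \<noteq> 0" "w - z0 \<noteq> 0" using zw denominator_out_nonzero by auto
    have "u_map l z0 z - u_map l z0 w = cnj (2 * (w - z) / ((z - z0) * (w - z0)))"
      using zw nz by (simp add: u_map_out divide_simps flip: complex_cnj_diff) (simp add: algebra_simps)
    then have "dist (u_map l z0 z) (u_map l z0 w) = 2 * dist z w / (norm (z - z0) * norm (w - z0))"
      by (simp only: dist_norm complex_mod_cnj) (simp add: norm_mult norm_divide norm_minus_commute del: right_diff_distrib_numeral)
    also have "\<dots> \<le> 2 * dist z w / ((l - norm z0) * (l - norm z0))"
      using pos zw nz by (intro divide_left_mono mult_mono mult_pos_pos norm_denominator_out) auto
    also have "\<dots> = ?L * dist z w" by (simp add: power2_eq_square)
    finally show "dist (u_map l z0 z) (u_map l z0 w) \<le> ?L * dist z w" .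
  qed simp
qed

lemma has_derivative_u_map:
  assumes "norm z \<noteq> l"
  shows "(u_map l z0 has_derivative u_deriv l z0 z) (at z)"
proof (cases "norm z < l")
  case True
  have nz: "(of_real l)\<^sup>2 - cnj z0 * z \<noteq> 0" using True denominator_in_nonzero by simp
  have "((\<lambda>z. 2 * z / ((of_real l)\<^sup>2 - cnj z0 * z)) has_field_derivative
      2 * (of_real l)\<^sup>2 / ((of_real l)\<^sup>2 - cnj z0 * z)\<^sup>2) (at z)"
    using nz by (auto intro!: derivative_eq_intros simp: field_simps power2_eq_square)
  then have "((\<lambda>z. 2 * z / ((of_real l)\<^sup>2 - cnj z0 * z)) has_derivative u_deriv l z0 z) (at z)"
    using True by (simp add: has_field_derivative_def u_deriv_def[abs_def] del: times_divide_eq_left)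
  then show ?thesis
    by (rule has_derivative_transform_within_open[where s="ball 0 l"])
      (use True in \<open>auto simp: u_map_def\<close>)
next
  case False
  have nz: "z - z0 \<noteq> 0" using False denominator_out_nonzero by simp
  have "((\<lambda>z. 2 / (z - z0)) has_field_derivative - 2 / (z - z0)\<^sup>2) (at z)"
    using nz by (auto intro!: derivative_eq_intros simp: field_simps power2_eq_square)
  then have "((\<lambda>z. 2 / (z - z0)) has_derivative (\<lambda>h. - 2 / (z - z0)\<^sup>2 * h)) (at z)"
    unfolding has_field_derivative_def .
  from bounded_linear.has_derivative[OF bounded_linear_cnj this]
  have "((\<lambda>z. cnj (2 / (z - z0))) has_derivative u_deriv l z0 z) (at z)"
    using False by (simp add: u_deriv_def[abs_def])
  then show ?thesis
    by (rule has_derivative_transform_within_open[where s="- cball 0 l"])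
      (use False assms in \<open>auto simp: u_map_out\<close>)
qed

lemma AE_has_derivative_u_map: "AE z in lebesgue. (u_map l z0 has_derivative u_deriv l z0 z) (at z)"
proof -
  have "AE z in lebesgue. z \<notin> sphere (0::complex) l"
    using negligible_sphere by (intro AE_not_in) (simp add: negligible_iff_null_sets)
  then show ?thesis
    by eventually_elim (auto intro: has_derivative_u_map)
qed

lemma u_deriv_measurable: "(\<lambda>z. u_deriv l z0 z h) \<in> borel_measurable borel"
  unfolding u_deriv_def
proof (rule borel_measurable_continuous_on_if)
  show "continuous_on (ball 0 l)
      (\<lambda>z. 2 * (of_real l)\<^sup>2 / ((of_real l)\<^sup>2 - cnj z0 * z)\<^sup>2 * h)"
    using denominator_in_nonzero by (intro continuous_intros) auto
  show "continuous_on (- ball 0 l) (\<lambda>z. cnj (- 2 / (z - z0)\<^sup>2 * h))"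
    using denominator_out_nonzero by (intro continuous_intros) auto
qed simp

lemma has_weak_partial_u_map:
  assumes "e \<in> Basis"
  shows "has_weak_partial (u_map l z0) e (\<lambda>z. u_deriv l z0 z e)"
    "locally_Lp p (\<lambda>z. u_deriv l z0 z e)"
  using u_deriv_measurable
  by (intro has_weak_partial_lipschitz[OF lipschitz_on_u_map assms AE_has_derivative_u_map]
      measurable_completion; simp)+

lemma u_map_admissible: "u_map l z0 \<in> admissible (ball 0 l) z0"
proof -
  have "locally_Lp 2 (u_map l z0)"
    by (rule locally_Lp_continuous[OF lipschitz_on_continuous_on[OF lipschitz_on_u_map]])
  then have "H1_loc (u_map l z0)"
    unfolding H1_loc_def using has_weak_partial_u_map by blast
  moreover have "AE z in lebesgue. z \<notin> ball 0 l \<longrightarrow> u_map l z0 z = 2 / (cnj z - cnj z0)"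
    by (simp add: u_map_def)
  ultimately show ?thesis by (simp add: admissible_def)
qed

end

text \<open>Uniqueness frees the energy from the choice hidden in \<open>weak_partial\<close>: any
  weak derivatives at hand compute it.\<close>

lemma dirichlet_energy_eq:
  assumes "\<And>e. e \<in> Basis \<Longrightarrow> has_weak_partial u e (g e)"
  shows "dirichlet_energy u = (\<integral>\<^sup>+x. ennreal (\<Sum>e\<in>Basis. (norm (g e x))\<^sup>2) \<partial>lebesgue)"
proof -
  have "AE x in lebesgue. weak_partial u e x = g e x" if "e \<in> Basis" for e
    using has_weak_partial_unique[OF has_weak_partial_weak_partial assms] assms that by blast
  then have "AE x in lebesgue. \<forall>e\<in>Basis. weak_partial u e x = g e x"
    by (simp add: AE_finite_all[OF finite_Basis])
  then show ?thesis
    unfolding dirichlet_energy_def by (intro nn_integral_cong_AE) (auto elim!: eventually_mono)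
qed

section \<open>Orthogonality\<close>

text \<open>Since the inner branch of the minimiser is holomorphic on a disc of radius \<open>R > l\<close>, its gradient
  multiplied by a cutoff is an admissible test field, so no boundary traces are needed. The
  Cauchy-Riemann equations make the divergence of this field vanish inside the ball.\<close>

lemma integral_holomorphic_gradient_eq_0:
  fixes f w g1 gi :: "complex \<Rightarrow> complex"
  assumes l: "0 < l" "l < R" and f: "f holomorphic_on ball 0 R"
    and g1: "has_weak_partial w 1 g1" and gi: "has_weak_partial w \<i> gi"
    and w: "AE z in lebesgue. z \<notin> ball 0 l \<longrightarrow> w z = 0"
    and D1: "\<And>z. z \<in> ball 0 l \<Longrightarrow> D1 z = f z" and Di: "\<And>z. z \<in> ball 0 l \<Longrightarrow> Di z = \<i> * f z"
  shows "integrable lebesgue (\<lambda>z. D1 z \<bullet> g1 z + Di z \<bullet> gi z)"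
    "(\<integral>z. D1 z \<bullet> g1 z + Di z \<bullet> gi z \<partial>lebesgue) = 0"
proof -
  obtain \<eta> :: "complex \<Rightarrow> real" where \<eta>: "smooth_on UNIV \<eta>" "\<And>z. norm z \<le> l \<Longrightarrow> \<eta> z = 1"
    "\<And>z. (l + R) / 2 \<le> norm z \<Longrightarrow> \<eta> z = 0"
    using exists_cutoff_function[of l "(l + R) / 2"] l by auto
  define a where "a z = \<eta> z * Re (f z)" for z
  define b where "b z = \<eta> z * Im (f z)" for z
  have lR: "(l + R) / 2 < R" using l by simp
  have a: "test_function a"
    unfolding a_def[abs_def]
    by (rule test_function_mult_cutoff[OF \<eta>(1,3) smooth_on_Re_holomorphic[OF open_ball f] lR])
  have b: "test_function b"
    unfolding b_def[abs_def]
    by (rule test_function_mult_cutoff[OF \<eta>(1,3) smooth_on_Im_holomorphic[OF open_ball f] lR])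
  let ?d = "\<lambda>\<phi> e z. frechet_derivative \<phi> (at z) e"
  have da: "?d a e z = Re (deriv f z * e)" and db: "?d b e z = Im (deriv f z * e)"
    if z: "z \<in> ball 0 l" for e z
  proof -
    have f': "(f has_derivative (\<lambda>h. deriv f z * h)) (at z)"
      using holomorphic_derivI[OF f open_ball, of z] z l by (simp add: has_field_derivative_def)
    have "(a has_derivative (\<lambda>h. Re (deriv f z * h))) (at z)"
      by (rule has_derivative_transform_within_open[OF bounded_linear.has_derivative[OF bounded_linear_Re f']
            open_ball z]) (simp add: a_def \<eta>(2))
    then show "?d a e z = Re (deriv f z * e)" using frechet_derivative_at by metis
    have "(b has_derivative (\<lambda>h. Im (deriv f z * h))) (at z)"
      by (rule has_derivative_transform_within_open[OF bounded_linear.has_derivative[OF bounded_linear_Im f']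
            open_ball z]) (simp add: b_def \<eta>(2))
    then show "?d b e z = Im (deriv f z * e)" using frechet_derivative_at by metis
  qed
  have Lw: "locally_Lp 1 w" and L1: "locally_Lp 1 g1" and Li: "locally_Lp 1 gi"
    using g1 gi by (auto simp: has_weak_partial_def)
  have B: "(1::complex) \<in> Basis" "\<i> \<in> Basis" by (auto simp: Basis_complex_def)
  note int_g = test_function_integrable_scaleR[OF a L1] test_function_integrable_scaleR[OF b L1]
    test_function_integrable_scaleR[OF a Li] test_function_integrable_scaleR[OF b Li]
  note int_w = test_function_integrable_scaleR[OF test_function_derivative[OF a B(1)] Lw]
    test_function_integrable_scaleR[OF test_function_derivative[OF a B(2)] Lw]
    test_function_integrable_scaleR[OF test_function_derivative[OF b B(1)] Lw]
    test_function_integrable_scaleR[OF test_function_derivative[OF b B(2)] Lw]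
  have parts: "(\<integral>z. ?d \<phi> 1 z *\<^sub>R w z \<partial>lebesgue) = - (\<integral>z. \<phi> z *\<^sub>R g1 z \<partial>lebesgue)"
    "(\<integral>z. ?d \<phi> \<i> z *\<^sub>R w z \<partial>lebesgue) = - (\<integral>z. \<phi> z *\<^sub>R gi z \<partial>lebesgue)"
    if "test_function \<phi>" for \<phi>
    using g1 gi that by (auto simp: has_weak_partial_def)
  \<comment> \<open>Inside the disc f = a + ib and \<i> f = -b + ia, so the pairing is Re (a g1 - b
    gi) + Im (b g1 + a gi). Both integrals vanish: after integration by parts the coefficients of
    \<open>w\<close> are a_x - b_y and b_x + a_y, which are 0 in the disc by Cauchy-Riemann, and
    \<open>w\<close> is 0 elsewhere.\<close>
  have P: "(\<integral>z. a z *\<^sub>R g1 z - b z *\<^sub>R gi z \<partial>lebesgue) = 0"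
  proof -
    have "(\<integral>z. a z *\<^sub>R g1 z - b z *\<^sub>R gi z \<partial>lebesgue)
        = - (\<integral>z. ?d a 1 z *\<^sub>R w z - ?d b \<i> z *\<^sub>R w z \<partial>lebesgue)"
      using int_g int_w by (simp add: parts[OF a] parts[OF b])
    also have "(\<integral>z. ?d a 1 z *\<^sub>R w z - ?d b \<i> z *\<^sub>R w z \<partial>lebesgue) = 0"
    proof (rule integral_eq_zero_AE)
      show "AE z in lebesgue. ?d a 1 z *\<^sub>R w z - ?d b \<i> z *\<^sub>R w z = 0"
        using w
      proof eventually_elim
        case (elim z)
        then show ?case by (cases "z \<in> ball 0 l") (auto simp: da db)
      qed
    qed
    finally show ?thesis by simp
  qed
  have Q: "(\<integral>z. b z *\<^sub>R g1 z + a z *\<^sub>R gi z \<partial>lebesgue) = 0"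
  proof -
    have "(\<integral>z. b z *\<^sub>R g1 z + a z *\<^sub>R gi z \<partial>lebesgue)
        = - (\<integral>z. ?d b 1 z *\<^sub>R w z + ?d a \<i> z *\<^sub>R w z \<partial>lebesgue)"
      using int_g int_w by (simp add: parts[OF a] parts[OF b])
    also have "(\<integral>z. ?d b 1 z *\<^sub>R w z + ?d a \<i> z *\<^sub>R w z \<partial>lebesgue) = 0"
    proof (rule integral_eq_zero_AE)
      show "AE z in lebesgue. ?d b 1 z *\<^sub>R w z + ?d a \<i> z *\<^sub>R w z = 0"
        using w
      proof eventually_elim
        case (elim z)
        then show ?case by (cases "z \<in> ball 0 l") (auto simp: da db)
      qed
    qed
    finally show ?thesis by simp
  qed
  let ?p = "\<lambda>z. a z *\<^sub>R g1 z - b z *\<^sub>R gi z" and ?q = "\<lambda>z. b z *\<^sub>R g1 z + a z *\<^sub>R gi z"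
  have pq: "integrable lebesgue ?p" "integrable lebesgue ?q" using int_g by auto
  then have int_pq: "integrable lebesgue (\<lambda>z. Re (?p z) + Im (?q z))"
    by (rule Bochner_Integration.integrable_add[OF integrable_Re integrable_Im])
  \<comment> \<open>Beyond the circle neither \<open>D1\<close> and \<open>Di\<close> nor the
    cut-off field is controlled; there the weak derivatives of \<open>w\<close> vanish by locality,
    and the circle is null.\<close>
  have "AE z in lebesgue. z \<notin> sphere (0::complex) l"
    using negligible_sphere by (intro AE_not_in) (simp add: negligible_iff_null_sets)
  moreover have w': "AE z in lebesgue. z \<in> - cball 0 l \<longrightarrow> w z = 0"
    using w by eventually_elim auto
  have "AE z in lebesgue. z \<in> - cball 0 l \<longrightarrow> g1 z = 0"
    by (rule has_weak_partial_eq_0[OF _ g1 w']) auto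
  moreover have "AE z in lebesgue. z \<in> - cball 0 l \<longrightarrow> gi z = 0"
    by (rule has_weak_partial_eq_0[OF _ gi w']) auto
  ultimately have ae: "AE z in lebesgue. D1 z \<bullet> g1 z + Di z \<bullet> gi z = Re (?p z) + Im (?q z)"
  proof eventually_elim
    case (elim z)
    show ?case
    proof (cases "z \<in> ball 0 l")
      case True
      then show ?thesis
        by (simp add: D1 Di a_def b_def \<eta>(2) inner_complex_def)
    qed (use elim in auto)
  qed
  \<comment> \<open>Measurability comes from almost everywhere equality with a measurable function,
    the measure being complete.\<close>
  have meas: "(\<lambda>z. D1 z \<bullet> g1 z + Di z \<bullet> gi z) \<in> borel_measurable lebesgue"
    by (rule borel_measurable_AE[OF borel_measurable_integrable[OF int_pq]])
      (use ae in eventually_elim, simp only: refl)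
  show "integrable lebesgue (\<lambda>z. D1 z \<bullet> g1 z + Di z \<bullet> gi z)"
    using integrable_cong_AE[OF meas borel_measurable_integrable[OF int_pq] ae] int_pq by blast
  have "(\<integral>z. D1 z \<bullet> g1 z + Di z \<bullet> gi z \<partial>lebesgue) = (\<integral>z. Re (?p z) + Im (?q z) \<partial>lebesgue)"
    by (rule integral_cong_AE[OF meas borel_measurable_integrable[OF int_pq] ae])
  also have "\<dots> = Re (\<integral>z. ?p z \<partial>lebesgue) + Im (\<integral>z. ?q z \<partial>lebesgue)"
    using pq by (simp only: Bochner_Integration.integral_add integrable_Re integrable_Im integral_Re integral_Im)
  also have "\<dots> = 0" by (simp only: P Q) simp
  finally show "(\<integral>z. D1 z \<bullet> g1 z + Di z \<bullet> gi z \<partial>lebesgue) = 0" .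
qed

text \<open>The excess is kept as a number \<open>B\<close>, so one expansion of the square yields
  both minimality and uniqueness: B = 0 annihilates the gradient of the difference, which vanishes
  outside the disc. Finite energy of the map allows the expansion to be integrated termwise in the
  reals.\<close>

lemma dirichlet_energy_admissible:
  assumes z0: "norm z0 < l" and fin: "dirichlet_energy (u_map l z0) < \<infinity>"
    and v: "v \<in> admissible (ball 0 l) z0"
  obtains B where "0 \<le> B" "dirichlet_energy v = dirichlet_energy (u_map l z0) + ennreal B"
    "B = 0 \<Longrightarrow> AE z in lebesgue. v z = u_map l z0 z"
proof -
  have l: "0 < l" by (rule radius_pos[OF z0])
  have Basis: "(1::complex) \<in> Basis" "\<i> \<in> Basis" by (auto simp: Basis_complex_def)
  let ?D = "\<lambda>e z. u_deriv l z0 z e"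
  note D = has_weak_partial_u_map[OF z0]
  have H1: "H1_loc v" and v_out: "AE z in lebesgue. z \<notin> ball 0 l \<longrightarrow> v z = 2 / (cnj z - cnj z0)"
    using v by (auto simp: admissible_def)
  obtain g1 where g1: "locally_Lp 2 g1" "has_weak_partial v 1 g1"
    using H1 Basis(1) unfolding H1_loc_def by blast
  obtain gi where gi: "locally_Lp 2 gi" "has_weak_partial v \<i> gi"
    using H1 Basis(2) unfolding H1_loc_def by blast
  define w where "w z = v z - u_map l z0 z" for z
  define h1 where "h1 z = g1 z - ?D 1 z" for z
  define hi where "hi z = gi z - ?D \<i> z" for z
  have h1: "has_weak_partial w 1 h1" and hi: "has_weak_partial w \<i> hi"
    unfolding w_def[abs_def] h1_def[abs_def] hi_def[abs_def]
    by (rule has_weak_partial_diff g1 gi D Basis)+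
  have w: "AE z in lebesgue. z \<notin> ball 0 l \<longrightarrow> w z = 0"
    using v_out by eventually_elim (auto simp: w_def u_map_def)
  have w': "AE z in lebesgue. z \<in> - cball 0 l \<longrightarrow> w z = 0"
    using w by eventually_elim auto
  have h1_out: "AE z in lebesgue. z \<in> - cball 0 l \<longrightarrow> h1 z = 0"
    by (rule has_weak_partial_eq_0[OF _ h1 w']) auto
  have hi_out: "AE z in lebesgue. z \<in> - cball 0 l \<longrightarrow> hi z = 0"
    by (rule has_weak_partial_eq_0[OF _ hi w']) auto
  \<comment> \<open>The inner gradient has its pole at distance l^2 / |z0|. \<open>R\<close> is the
    harmonic mean of l and this distance, written so that it also makes sense for z0 = 0, where it
    is 2 l.\<close>
  define R where "R = 2 * l\<^sup>2 / (l + norm z0)"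
  have pos: "0 < l + norm z0" using l norm_ge_zero[of z0] by linarith
  have lR: "l < R"
    using mult_strict_left_mono[OF z0 l]
    by (simp add: R_def pos_less_divide_eq[OF pos] algebra_simps power2_eq_square)
  have hol: "(\<lambda>z. 2 * (of_real l)\<^sup>2 / ((of_real l)\<^sup>2 - cnj z0 * z)\<^sup>2) holomorphic_on ball 0 R"
  proof -
    have "(of_real l)\<^sup>2 - cnj z0 * z \<noteq> 0" if "norm z < R" for z
    proof
      assume "(of_real l)\<^sup>2 - cnj z0 * z = 0"
      then have "norm z0 * norm z = l\<^sup>2"
        by (metis complex_mod_cnj eq_iff_diff_eq_0 norm_mult norm_of_real norm_power power2_abs)
      moreover have "norm z0 * norm z \<le> norm z0 * R" using that by (intro mult_left_mono) auto
      moreover have "norm z0 * R < l\<^sup>2"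
        using mult_strict_left_mono[OF z0, of "l\<^sup>2"] l
        by (simp add: R_def pos_divide_less_eq[OF pos] algebra_simps)
      ultimately show False by simp
    qed
    then show ?thesis by (intro holomorphic_intros) auto
  qed
  have X: "integrable lebesgue (\<lambda>z. ?D 1 z \<bullet> h1 z + ?D \<i> z \<bullet> hi z)"
      "(\<integral>z. ?D 1 z \<bullet> h1 z + ?D \<i> z \<bullet> hi z \<partial>lebesgue) = 0"
    by (rule integral_holomorphic_gradient_eq_0[OF l lR hol h1 hi w]; simp add: u_deriv_def)+
  define A where "A z = (norm (?D 1 z))\<^sup>2 + (norm (?D \<i> z))\<^sup>2" for z
  define B where "B z = (norm (h1 z))\<^sup>2 + (norm (hi z))\<^sup>2" for z
  have Dm: "?D e \<in> borel_measurable lebesgue" for e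
    using u_deriv_measurable[OF z0] by (intro measurable_completion) simp
  have hm: "h1 \<in> borel_measurable lebesgue" "hi \<in> borel_measurable lebesgue"
    using g1(1) gi(1) Dm unfolding h1_def[abs_def] hi_def[abs_def] locally_Lp_def
    by (auto intro: borel_measurable_diff)
  have energy_u: "dirichlet_energy (u_map l z0) = (\<integral>\<^sup>+z. ennreal (A z) \<partial>lebesgue)"
    using dirichlet_energy_eq[of "u_map l z0" ?D] D(1) by (simp add: A_def Basis_complex_def)
  have Am: "A \<in> borel_measurable lebesgue"
    unfolding A_def[abs_def] using Dm
    by (intro borel_measurable_add borel_measurable_power measurable_compose[OF _ borel_measurable_norm])
  have Bm: "B \<in> borel_measurable lebesgue"
    unfolding B_def[abs_def] using hm
    by (intro borel_measurable_add borel_measurable_power measurable_compose[OF _ borel_measurable_norm])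
  have A: "integrable lebesgue A"
    using Am fin by (intro integrableI_nonneg) (auto simp: energy_u A_def)
  \<comment> \<open>Weak derivatives of a competitor are only locally square integrable, but
    \<open>h1\<close> and \<open>hi\<close> vanish outside the closed disc, so truncation to that
    compact set gives a global bound.\<close>
  have B: "integrable lebesgue B"
  proof (rule Bochner_Integration.integrable_bound[OF _ Bm])
    let ?K = "cball (0::complex) l"
    let ?n = "\<lambda>f z. indicator ?K z *\<^sub>R norm (f z :: complex) ^ 2"
    have "integrable lebesgue (?n f)" if "locally_Lp 2 f" for f
      using that[unfolded locally_Lp_def set_integrable_def, THEN conjunct2, rule_format, OF compact_cball] .
    then show "integrable lebesgue (\<lambda>z. 2 * (?n g1 z + ?n (?D 1) z) + 2 * (?n gi z + ?n (?D \<i>) z))"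
      using g1(1) gi(1) D(2)[OF Basis(1)] D(2)[OF Basis(2)]
      by (intro Bochner_Integration.integrable_add integrable_mult_right) auto
    have tri: "(norm (x - y))\<^sup>2 \<le> 2 * ((norm x)\<^sup>2 + (norm y)\<^sup>2)" for x y :: complex
    proof -
      have "(norm (x - y))\<^sup>2 \<le> (norm x + norm y)\<^sup>2"
        by (intro power_mono norm_triangle_ineq4) auto
      also have "\<dots> \<le> 2 * ((norm x)\<^sup>2 + (norm y)\<^sup>2)"
        using zero_le_power2[of "norm x - norm y"] by (simp add: power2_sum power2_diff)
      finally show ?thesis .
    qed
    show "AE z in lebesgue. norm (B z)
        \<le> norm (2 * (?n g1 z + ?n (?D 1) z) + 2 * (?n gi z + ?n (?D \<i>) z))"
      using h1_out hi_out
    proof eventually_elim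
      case (elim z)
      show ?case
      proof (cases "z \<in> ?K")
        case True
        have "B z \<le> 2 * (?n g1 z + ?n (?D 1) z) + 2 * (?n gi z + ?n (?D \<i>) z)"
          using True tri[of "g1 z" "?D 1 z"] tri[of "gi z" "?D \<i> z"]
          unfolding B_def h1_def hi_def by (intro add_mono) auto
        moreover have "0 \<le> B z" by (simp add: B_def)
        ultimately show ?thesis by simp
      qed (use elim in \<open>simp add: B_def\<close>)
    qed
  qed
  have "dirichlet_energy v = (\<integral>\<^sup>+z. ennreal (\<Sum>e\<in>(Basis :: complex set). (norm (if e = 1 then g1 z else gi z))\<^sup>2) \<partial>lebesgue)"
    by (rule dirichlet_energy_eq[where g="\<lambda>(e::complex) z. if e = 1 then g1 z else gi z"])
      (use g1(2) gi(2) in \<open>auto simp: Basis_complex_def\<close>)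
  also have "\<dots> = (\<integral>\<^sup>+z. ennreal (A z + 2 * (?D 1 z \<bullet> h1 z + ?D \<i> z \<bullet> hi z) + B z) \<partial>lebesgue)"
  proof (intro nn_integral_cong arg_cong[of _ _ ennreal])
    fix z
    have sq: "(norm x)\<^sup>2 = (norm y)\<^sup>2 + 2 * (y \<bullet> (x - y)) + (norm (x - y))\<^sup>2" for x y :: complex
      by (simp add: power2_norm_eq_inner algebra_simps inner_commute)
    show "(\<Sum>e\<in>(Basis :: complex set). (norm (if e = 1 then g1 z else gi z))\<^sup>2)
        = A z + 2 * (?D 1 z \<bullet> h1 z + ?D \<i> z \<bullet> hi z) + B z"
      using sq[of "g1 z" "?D 1 z"] sq[of "gi z" "?D \<i> z"]
      by (simp add: Basis_complex_def A_def B_def h1_def hi_def)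
  qed
  \<comment> \<open>The cross term has no sign, so it is split off among real integrals; the whole
    integrand is a sum of squares and hence nonnegative.\<close>
  also have "\<dots> = ennreal (\<integral>z. A z + 2 * (?D 1 z \<bullet> h1 z + ?D \<i> z \<bullet> hi z) + B z \<partial>lebesgue)"
  proof (rule nn_integral_eq_integral)
    show "integrable lebesgue (\<lambda>z. A z + 2 * (?D 1 z \<bullet> h1 z + ?D \<i> z \<bullet> hi z) + B z)"
      by (intro Bochner_Integration.integrable_add integrable_mult_right A B X(1))
    have "0 \<le> A z + 2 * (?D 1 z \<bullet> h1 z + ?D \<i> z \<bullet> hi z) + B z" for z
    proof -
      have "A z + 2 * (?D 1 z \<bullet> h1 z + ?D \<i> z \<bullet> hi z) + B z
          = (norm (?D 1 z + h1 z))\<^sup>2 + (norm (?D \<i> z + hi z))\<^sup>2"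
        by (simp add: A_def B_def power2_norm_eq_inner algebra_simps inner_commute)
      then show ?thesis by simp
    qed
    then show "AE z in lebesgue. 0 \<le> A z + 2 * (?D 1 z \<bullet> h1 z + ?D \<i> z \<bullet> hi z) + B z" by simp
  qed
  also have "(\<integral>z. A z + 2 * (?D 1 z \<bullet> h1 z + ?D \<i> z \<bullet> hi z) + B z \<partial>lebesgue)
      = integral\<^sup>L lebesgue A + integral\<^sup>L lebesgue B"
  proof -
    have "(\<integral>z. A z + 2 * (?D 1 z \<bullet> h1 z + ?D \<i> z \<bullet> hi z) + B z \<partial>lebesgue)
      = (\<integral>z. A z + 2 * (?D 1 z \<bullet> h1 z + ?D \<i> z \<bullet> hi z) \<partial>lebesgue) + integral\<^sup>L lebesgue B"
      by (intro Bochner_Integration.integral_add Bochner_Integration.integrable_add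
          integrable_mult_right A B X(1))
    also have "(\<integral>z. A z + 2 * (?D 1 z \<bullet> h1 z + ?D \<i> z \<bullet> hi z) \<partial>lebesgue)
      = integral\<^sup>L lebesgue A + (\<integral>z. 2 * (?D 1 z \<bullet> h1 z + ?D \<i> z \<bullet> hi z) \<partial>lebesgue)"
      by (intro Bochner_Integration.integral_add integrable_mult_right A X(1))
    also have "(\<integral>z. 2 * (?D 1 z \<bullet> h1 z + ?D \<i> z \<bullet> hi z) \<partial>lebesgue) = 0"
      by (simp only: integral_mult_right_zero X(2) mult_zero_right)
    finally show ?thesis by simp
  qed
  also have "ennreal (integral\<^sup>L lebesgue A + integral\<^sup>L lebesgue B)
      = ennreal (integral\<^sup>L lebesgue A) + ennreal (integral\<^sup>L lebesgue B)"
    by (rule ennreal_plus) (auto simp: A_def B_def intro!: Bochner_Integration.integral_nonneg)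
  also have "ennreal (integral\<^sup>L lebesgue A) = dirichlet_energy (u_map l z0)"
    unfolding energy_u by (rule nn_integral_eq_integral[symmetric, OF A]) (simp add: A_def)
  finally have energy_v: "dirichlet_energy v
    = dirichlet_energy (u_map l z0) + ennreal (integral\<^sup>L lebesgue B)" .
  show ?thesis
  proof (rule that[OF _ energy_v])
    show "0 \<le> integral\<^sup>L lebesgue B" by (simp add: B_def)
    assume "integral\<^sup>L lebesgue B = 0"
    then have "AE z in lebesgue. B z = 0"
      by (subst (asm) integral_nonneg_eq_0_iff_AE[OF B]) (auto simp: B_def)
    then have "AE z in lebesgue. h1 z = 0"
      by eventually_elim (simp add: B_def add_nonneg_eq_0_iff)
    \<comment> \<open>One vanishing partial derivative is enough, because \<open>w\<close> is zero
      outside a ball.\<close>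
    then have "AE z in lebesgue. w z = 0"
    proof (rule AE_eq_0_of_weak_partial_eq_0[OF Basis(1) h1])
      show "AE z in lebesgue. l \<le> norm z \<longrightarrow> w z = 0"
        using w by eventually_elim auto
    qed
    then show "AE z in lebesgue. v z = u_map l z0 z"
      by eventually_elim (simp add: w_def)
  qed
qed

section \<open>The energy of the minimiser\<close>

definition complex_of_vec :: "real ^ 2 \<Rightarrow> complex" where
  "complex_of_vec x = Complex (x $ 1) (x $ 2)"

definition vec_of_complex :: "complex \<Rightarrow> real ^ 2" where
  "vec_of_complex z = vector [Re z, Im z]"

lemma complex_of_vec_of_complex [simp]: "complex_of_vec (vec_of_complex z) = z"
  by (simp add: complex_of_vec_def vec_of_complex_def)

lemma vec_of_complex_of_vec [simp]: "vec_of_complex (complex_of_vec x) = x"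
  by (simp add: complex_of_vec_def vec_of_complex_def vec_eq_iff forall_2)

lemma bounded_linear_complex_of_vec: "bounded_linear complex_of_vec"
  by (auto simp: linear_conv_bounded_linear[symmetric] complex_of_vec_def complex_eq_iff intro!: linearI)

lemma bounded_linear_vec_of_complex: "bounded_linear vec_of_complex"
  by (auto simp: linear_conv_bounded_linear[symmetric] vec_of_complex_def vec_eq_iff forall_2
      intro!: linearI)

lemma measurable_complex_of_vec: "complex_of_vec \<in> borel_measurable borel"
  by (intro borel_measurable_continuous_onI linear_continuous_on bounded_linear_complex_of_vec)

lemma Basis_vec_2: "(Basis :: (real ^ 2) set) = {axis 1 1, axis 2 1}"
  by (auto simp: Basis_vec_def UNIV_2)

text \<open>Lebesgue measure is determined by its values on boxes, and boxes correspond to boxes.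
  This carries the change of variables, performed on \<open>real ^ 2\<close> where determinants are
  available, over to the complex plane.\<close>

lemma distr_complex_of_vec: "distr lborel borel complex_of_vec = lborel"
proof (rule lborel_eqI[symmetric])
  fix a b :: complex assume ab: "\<And>e. e \<in> Basis \<Longrightarrow> a \<bullet> e \<le> b \<bullet> e"
  have le: "Re a \<le> Re b" "Im a \<le> Im b"
    using ab[of 1] ab[of \<i>] by (auto simp: Basis_complex_def)
  have "complex_of_vec -` box a b = box (vec_of_complex a) (vec_of_complex b)"
    by (auto simp: mem_box_cart forall_2 complex_of_vec_def vec_of_complex_def in_box_complex_iff)
  moreover have "emeasure lborel (box (vec_of_complex a) (vec_of_complex b))
      = ennreal ((Re b - Re a) * (Im b - Im a))"
    using le by (subst emeasure_lborel_box)
      (auto simp: Basis_vec_2 inner_axis axis_eq_axis vec_of_complex_def)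
  ultimately show "emeasure (distr lborel borel complex_of_vec) (box a b) = (\<Prod>e\<in>Basis. (b - a) \<bullet> e)"
    by (simp add: emeasure_distr measurable_complex_of_vec Basis_complex_def)
qed simp

text \<open>Multiplication by p + iq has the real matrix with rows (p, -q) and (q, p), so the
  Jacobian determinant of a holomorphic map is the squared modulus of its derivative.\<close>

lemma nn_integral_norm_deriv_eq_area:
  fixes h h' :: "complex \<Rightarrow> complex"
  assumes S: "open S" and der: "\<And>z. z \<in> S \<Longrightarrow> (h has_field_derivative h' z) (at z)"
    and inj: "inj_on h S" and cont: "continuous_on S h'"
    and im: "h ` S \<in> sets borel" "emeasure lborel (h ` S) < \<infinity>"
  shows "(\<integral>\<^sup>+z. ennreal ((norm (h' z))\<^sup>2) * indicator S z \<partial>lborel) = emeasure lborel (h ` S)"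
proof -
  let ?c = complex_of_vec and ?v = vec_of_complex
  let ?S = "?c -` S"
  let ?F = "\<lambda>x. ?v (h (?c x))" and ?F' = "\<lambda>x d. ?v (h' (?c x) * ?c d)"
  have openS: "open ?S"
    using S by (rule open_vimage) (intro linear_continuous_on bounded_linear_complex_of_vec)
  have dF: "(?F has_derivative ?F' x) (at x within ?S)" if "x \<in> ?S" for x
  proof (rule has_derivative_at_withinI)
    have "(h has_derivative (\<lambda>d. h' (?c x) * d)) (at (?c x))"
      using der[of "?c x"] that by (simp add: has_field_derivative_def)
    from has_derivative_compose[OF bounded_linear_imp_has_derivative[OF bounded_linear_complex_of_vec] this]
    show "(?F has_derivative ?F' x) (at x)"
      by (rule bounded_linear.has_derivative[OF bounded_linear_vec_of_complex])
  qed
  have "inj_on ?F ?S"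
    using inj by (auto simp: inj_on_def) (metis complex_of_vec_of_complex vec_of_complex_of_vec)
  moreover have det: "\<bar>det (matrix (?F' x))\<bar> = (norm (h' (?c x)))\<^sup>2" for x
    by (simp add: det_2 matrix_def axis_def complex_of_vec_def vec_of_complex_def cmod_power2)
      (simp add: power2_eq_square)
  moreover have image: "?F ` ?S = ?c -` (h ` S)"
  proof (intro equalityI subsetI)
    fix y assume "y \<in> ?c -` (h ` S)"
    then obtain z where z: "z \<in> S" "?c y = h z" by auto
    then have "y = ?F (?v z)" by (metis complex_of_vec_of_complex vec_of_complex_of_vec)
    then show "y \<in> ?F ` ?S" using z(1) by (intro image_eqI[of _ _ "?v z"]) auto
  qed auto
  moreover have em: "emeasure lborel (?c -` (h ` S)) = emeasure lborel (h ` S)"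
    using emeasure_distr[of ?c lborel borel "h ` S"] im(1)
    by (simp add: distr_complex_of_vec measurable_complex_of_vec)
  moreover have b: "?c -` (h ` S) \<in> sets borel"
    using measurable_sets_borel[OF measurable_complex_of_vec im(1)] by simp
  ultimately have "((\<lambda>x. (norm (h' (?c x)))\<^sup>2) has_integral measure lborel (h ` S)) ?S"
    using has_measure_differentiable_image[of ?S ?F ?F' "measure lborel (h ` S)"] dF openS im(2)
    by (simp add: fmeasurable_def measure_def)
  from nn_integral_has_integral_lebesgue'[OF _ this]
  have "(\<integral>\<^sup>+x. ennreal ((norm (h' (?c x)))\<^sup>2) * indicator ?S x \<partial>lborel) = emeasure lborel (h ` S)"
    using im(2) by (simp add: emeasure_eq_ennreal_measure top.not_eq_extremum)
  moreover have "(\<integral>\<^sup>+z. ennreal ((norm (h' z))\<^sup>2) * indicator S z \<partial>distr lborel borel ?c)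
      = (\<integral>\<^sup>+x. ennreal ((norm (h' (?c x)))\<^sup>2) * indicator S (?c x) \<partial>lborel)"
  proof (rule nn_integral_distr)
    \<comment> \<open>\<open>h'\<close> is arbitrary off \<open>S\<close>; its extension by 0 is
      Borel and agrees with the integrand.\<close>
    have "(\<lambda>z. if z \<in> S then h' z else 0) \<in> borel_measurable borel"
      using S cont by (intro borel_measurable_continuous_on_if) auto
    then have "(\<lambda>z. ennreal ((norm (if z \<in> S then h' z else 0))\<^sup>2)) \<in> borel_measurable borel"
      by measurable
    moreover have "ennreal ((norm (if z \<in> S then h' z else 0))\<^sup>2) = ennreal ((norm (h' z))\<^sup>2) * indicator S z" for z
      by simp
    ultimately show "(\<lambda>z. ennreal ((norm (h' z))\<^sup>2) * indicator S z) \<in> borel_measurable (distr lborel borel ?c)"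
      by (simp cong: measurable_cong)
  qed (simp add: measurable_complex_of_vec)
  moreover have "indicator S (?c x) = (indicator ?S x :: ennreal)" for x by (simp add: indicator_def)
  ultimately show ?thesis by (simp add: distr_complex_of_vec)
qed

section \<open>Images of the disc and of its exterior under the two branches\<close>

lemma emeasure_lborel_ball_complex:
  "0 \<le> r \<Longrightarrow> emeasure lborel (ball (c::complex) r) = ennreal (pi * r\<^sup>2)"
  by (simp add: emeasure_ball unit_ball_vol_2)

lemma power2_less_iff_nonneg: "0 \<le> x \<Longrightarrow> 0 \<le> y \<Longrightarrow> x\<^sup>2 < y\<^sup>2 \<longleftrightarrow> x < (y::real)"
  by (auto intro: power2_less_imp_less power_strict_mono)

text \<open>The identity behind the disc automorphism z \<mapsto> l (z - a) / (l^2 - cnj a z): for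
  |a| < l the sign of l^2 - |z|^2 decides whether its value lies inside or outside the unit
  circle.\<close>

lemma mobius_norm_identity:
  "(norm ((of_real l)\<^sup>2 - cnj a * z))\<^sup>2 - l\<^sup>2 * (norm (z - a))\<^sup>2 = (l\<^sup>2 - (norm z)\<^sup>2) * (l\<^sup>2 - (norm a)\<^sup>2)"
proof -
  have 1: "Re ((of_real l)\<^sup>2 - cnj a * z) = l\<^sup>2 - (Re a * Re z + Im a * Im z)"
    "Im ((of_real l)\<^sup>2 - cnj a * z) = Im a * Re z - Re a * Im z"
    by (simp_all add: power2_eq_square)
  show ?thesis unfolding cmod_power2 1 by (simp add: algebra_simps power2_eq_square)
qed

context
  fixes l :: real and z0 :: complex
  assumes z0: "norm z0 < l"
begin

lemma l_power2_minus_pos: "0 < l\<^sup>2 - (norm z0)\<^sup>2"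
  using power_strict_mono[OF z0, of 2] by simp

lemma norm_less_mobius_iff: "l * norm (z - z0) < norm ((of_real l)\<^sup>2 - cnj z0 * z) \<longleftrightarrow> norm z < l"
proof -
  note l = radius_pos[OF z0]
  have "l * norm (z - z0) < norm ((of_real l)\<^sup>2 - cnj z0 * z)
      \<longleftrightarrow> (l * norm (z - z0))\<^sup>2 < (norm ((of_real l)\<^sup>2 - cnj z0 * z))\<^sup>2"
    using l by (simp add: power2_less_iff_nonneg)
  also have "\<dots> \<longleftrightarrow> 0 < (l\<^sup>2 - (norm z)\<^sup>2) * (l\<^sup>2 - (norm z0)\<^sup>2)"
    by (simp add: power_mult_distrib flip: mobius_norm_identity)
  also have "\<dots> \<longleftrightarrow> (norm z)\<^sup>2 < l\<^sup>2"
    using l_power2_minus_pos by (simp add: zero_less_mult_iff)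
  also have "\<dots> \<longleftrightarrow> norm z < l" using l by (simp add: power2_less_iff_nonneg)
  finally show ?thesis .
qed

lemma norm_greater_mobius_iff: "norm ((of_real l)\<^sup>2 - cnj z0 * z) < l * norm (z - z0) \<longleftrightarrow> l < norm z"
proof -
  note l = radius_pos[OF z0]
  have "norm ((of_real l)\<^sup>2 - cnj z0 * z) < l * norm (z - z0)
      \<longleftrightarrow> (norm ((of_real l)\<^sup>2 - cnj z0 * z))\<^sup>2 < (l * norm (z - z0))\<^sup>2"
    using l by (simp add: power2_less_iff_nonneg)
  also have "\<dots> \<longleftrightarrow> (l\<^sup>2 - (norm z)\<^sup>2) * (l\<^sup>2 - (norm z0)\<^sup>2) < 0"
    by (simp add: power_mult_distrib flip: mobius_norm_identity)
  also have "\<dots> \<longleftrightarrow> l\<^sup>2 < (norm z)\<^sup>2"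
    using l_power2_minus_pos by (simp add: mult_less_0_iff)
  also have "\<dots> \<longleftrightarrow> l < norm z" using l by (simp add: power2_less_iff_nonneg)
  finally show ?thesis .
qed

text \<open>Clears the denominator n = l^2 - |z0|^2 of centre and radius, so that both image
  computations reduce to the norm of n w - c.\<close>

lemma mem_ball_quotient_iff:
  assumes "0 < n"
  shows "(w::complex) \<in> ball (c / of_real n) (l / n) \<longleftrightarrow> norm (of_real n * w - c) < l"
proof -
  have "of_real n * w - c = of_real n * (w - c / of_real n)" using assms by (simp add: field_simps)
  then have "norm (of_real n * w - c) = n * norm (w - c / of_real n)"
    using assms by (simp add: norm_mult)
  then show ?thesis
    by (simp only: mem_ball dist_norm norm_minus_commute[of "c / of_real n" w]
        pos_less_divide_eq[OF assms] mult.commute[of n])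
qed

text \<open>With h(z) = z / (l^2 - cnj z0 z), which is half the inner branch, n h(z) - z0 = l^2 (z -
  z0) / (l^2 - cnj z0 z). Up to an affine map h is thus the disc automorphism, which reveals the
  centre z0 / n and the radius l / n.\<close>

lemma image_ball_mobius:
  "(\<lambda>z. z / ((of_real l)\<^sup>2 - cnj z0 * z)) ` ball 0 l
    = ball (z0 / of_real (l\<^sup>2 - (norm z0)\<^sup>2)) (l / (l\<^sup>2 - (norm z0)\<^sup>2))"
proof -
  define n where "n = l\<^sup>2 - (norm z0)\<^sup>2"
  define h where "h z = z / ((of_real l)\<^sup>2 - cnj z0 * z)" for z
  note l = radius_pos[OF z0]
  have n: "0 < n" using l_power2_minus_pos by (simp add: n_def)
  have n': "of_real n = (of_real l)\<^sup>2 - z0 * cnj z0"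
    by (simp add: n_def flip: complex_norm_square)
  have key: "norm (of_real n * h z - z0) < l \<longleftrightarrow> norm z < l"
    if d: "(of_real l)\<^sup>2 - cnj z0 * z \<noteq> 0" for z
  proof -
    have "of_real n * h z - z0 = (of_real l)\<^sup>2 * (z - z0) / ((of_real l)\<^sup>2 - cnj z0 * z)"
      using d by (simp add: n' h_def field_simps)
    then have "norm (of_real n * h z - z0) = l * (l * norm (z - z0)) / norm ((of_real l)\<^sup>2 - cnj z0 * z)"
      using l by (simp add: norm_mult norm_divide norm_power power2_eq_square)
    also have "\<dots> < l \<longleftrightarrow> l * norm (z - z0) < norm ((of_real l)\<^sup>2 - cnj z0 * z)"
      using l d by (simp add: divide_less_eq)
    finally show ?thesis by (simp add: norm_less_mobius_iff)
  qed
  have "h ` ball 0 l = ball (z0 / of_real n) (l / n)"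
  proof (intro equalityI subsetI)
    fix w assume "w \<in> h ` ball 0 l"
    then obtain z where z: "norm z < l" "w = h z" by auto
    then show "w \<in> ball (z0 / of_real n) (l / n)"
      unfolding mem_ball_quotient_iff[OF n] using key denominator_in_nonzero[OF z0, of z] by simp
  next
    fix w assume "w \<in> ball (z0 / of_real n) (l / n)"
    then have w: "norm (of_real n * w - z0) < l" unfolding mem_ball_quotient_iff[OF n] .
    \<comment> \<open>The pole of the inverse map is outside the image disc: 1 + cnj z0 w = 0 would
      give |z0| |n w - z0| = l^2, although |z0| < l and |n w - z0| < l.\<close>
    have nz: "1 + cnj z0 * w \<noteq> 0"
    proof
      assume "1 + cnj z0 * w = 0"
      then have "cnj z0 * w = -1" by (simp add: add_eq_0_iff)
      moreover have "cnj z0 * (of_real n * w - z0) = of_real n * (cnj z0 * w) - z0 * cnj z0"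
        by (simp add: algebra_simps)
      ultimately have "cnj z0 * (of_real n * w - z0) = - (of_real l)\<^sup>2"
        by (simp add: n')
      then have "norm z0 * norm (of_real n * w - z0) = l\<^sup>2"
        by (metis complex_mod_cnj norm_minus_cancel norm_mult norm_of_real norm_power power2_abs)
      moreover have "norm z0 * norm (of_real n * w - z0) \<le> norm z0 * l"
        using w by (intro mult_left_mono) auto
      moreover have "norm z0 * l < l\<^sup>2" using z0 l by (simp add: power2_eq_square)
      ultimately show False by simp
    qed
    \<comment> \<open>The solution of h z = w.\<close>
    define z where "z = (of_real l)\<^sup>2 * w / (1 + cnj z0 * w)"
    have d: "(of_real l)\<^sup>2 - cnj z0 * z = (of_real l)\<^sup>2 / (1 + cnj z0 * w)"
      using nz by (simp add: z_def field_simps)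
    then have d0: "(of_real l)\<^sup>2 - cnj z0 * z \<noteq> 0" using nz l by simp
    have "h z = w" unfolding h_def d using nz l by (simp add: z_def)
    moreover have "norm z < l" using key[OF d0] w \<open>h z = w\<close> by simp
    ultimately show "w \<in> h ` ball 0 l" by (intro image_eqI[of _ _ z]) auto
  qed
  then show ?thesis unfolding n_def h_def[abs_def] .
qed

text \<open>Here n / (z - z0) - cnj z0 = (l^2 - cnj z0 z) / (z - z0), the reciprocal situation to
  the disc. The removed point 0 would be the image of infinity. The conjugation in the outer branch
  is dropped, as it does not affect the norm of the gradient.\<close>

lemma image_exterior_inverse:
  "(\<lambda>z. 1 / (z - z0)) ` (- cball 0 l)
    = ball (cnj z0 / of_real (l\<^sup>2 - (norm z0)\<^sup>2)) (l / (l\<^sup>2 - (norm z0)\<^sup>2)) - {0}"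
proof -
  define n where "n = l\<^sup>2 - (norm z0)\<^sup>2"
  have n: "0 < n" using l_power2_minus_pos by (simp add: n_def)
  have n': "of_real n = (of_real l)\<^sup>2 - z0 * cnj z0"
    by (simp add: n_def flip: complex_norm_square)
  have key: "norm (of_real n * (1 / (z - z0)) - cnj z0) < l \<longleftrightarrow> l < norm z" if d: "z \<noteq> z0" for z
  proof -
    have "of_real n * (1 / (z - z0)) - cnj z0 = ((of_real l)\<^sup>2 - cnj z0 * z) / (z - z0)"
      using d by (simp add: n' field_simps)
    then have "norm (of_real n * (1 / (z - z0)) - cnj z0) = norm ((of_real l)\<^sup>2 - cnj z0 * z) / norm (z - z0)"
      by (simp only: norm_divide)
    also have "\<dots> < l \<longleftrightarrow> norm ((of_real l)\<^sup>2 - cnj z0 * z) < l * norm (z - z0)"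
      using d by (simp add: divide_less_eq)
    finally show ?thesis by (simp add: norm_greater_mobius_iff)
  qed
  have "(\<lambda>z. 1 / (z - z0)) ` (- cball 0 l) = ball (cnj z0 / of_real n) (l / n) - {0}"
  proof (intro equalityI subsetI)
    fix w assume "w \<in> (\<lambda>z. 1 / (z - z0)) ` (- cball 0 l)"
    then obtain z where z: "l < norm z" "w = 1 / (z - z0)" by (auto simp: not_le)
    then have "z \<noteq> z0" using z0 by auto
    with z key show "w \<in> ball (cnj z0 / of_real n) (l / n) - {0}"
      unfolding Diff_iff mem_ball_quotient_iff[OF n] by simp
  next
    fix w assume "w \<in> ball (cnj z0 / of_real n) (l / n) - {0}"
    then have w: "norm (of_real n * w - cnj z0) < l" "w \<noteq> 0"
      unfolding Diff_iff mem_ball_quotient_iff[OF n] by auto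
    define z where "z = z0 + 1 / w"
    have "z \<noteq> z0" "1 / (z - z0) = w" using w(2) by (auto simp: z_def)
    then have "l < norm z" using key[of z] w(1) by simp
    then show "w \<in> (\<lambda>z. 1 / (z - z0)) ` (- cball 0 l)"
      using \<open>1 / (z - z0) = w\<close> by (intro image_eqI[of _ _ z]) auto
  qed
  then show ?thesis unfolding n_def .
qed

lemma dirichlet_energy_u_map:
  "dirichlet_energy (u_map l z0) = ennreal (16 * pi * l\<^sup>2 / (l\<^sup>2 - (norm z0)\<^sup>2)\<^sup>2)"
proof -
  define n where "n = l\<^sup>2 - (norm z0)\<^sup>2"
  have n: "0 < n" using l_power2_minus_pos by (simp add: n_def)
  note l = radius_pos[OF z0]
  let ?d = "\<lambda>z. (of_real l)\<^sup>2 - cnj z0 * z"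
  let ?p = "\<lambda>z. (of_real l)\<^sup>2 / (?d z)\<^sup>2" and ?q = "\<lambda>z. - 1 / (z - z0)\<^sup>2"
  have in_area: "(\<integral>\<^sup>+z. ennreal ((norm (?p z))\<^sup>2) * indicator (ball 0 l) z \<partial>lborel) = ennreal (pi * (l / n)\<^sup>2)"
  proof -
    have dnz: "?d z \<noteq> 0" if "z \<in> ball 0 l" for z using denominator_in_nonzero[OF z0, of z] that by simp
    have im: "(\<lambda>z. z / ?d z) ` ball 0 l = ball (z0 / of_real n) (l / n)"
      using image_ball_mobius by (simp add: n_def)
    have area: "emeasure lborel ((\<lambda>z. z / ?d z) ` ball 0 l) = ennreal (pi * (l / n)\<^sup>2)"
      unfolding im using n l by (intro emeasure_lborel_ball_complex) simp
    show ?thesis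
      unfolding area[symmetric]
    proof (rule nn_integral_norm_deriv_eq_area)
      show "((\<lambda>z. z / ?d z) has_field_derivative ?p z) (at z)" if "z \<in> ball 0 l" for z
        using dnz[OF that] by (auto intro!: derivative_eq_intros simp: field_simps power2_eq_square)
      show "continuous_on (ball 0 l) ?p" using dnz by (intro continuous_intros) auto
      show "inj_on (\<lambda>z. z / ?d z) (ball 0 l)"
      proof (rule inj_onI)
        fix x y assume xy: "x \<in> ball 0 l" "y \<in> ball 0 l" "x / ?d x = y / ?d y"
        then have "x * ?d y = y * ?d x" using dnz[OF xy(1)] dnz[OF xy(2)] by (simp add: frac_eq_eq)
        then show "x = y" using l by (simp add: algebra_simps)
      qed
      show "emeasure lborel ((\<lambda>z. z / ?d z) ` ball 0 l) < \<infinity>" unfolding area by simp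
    qed (simp_all add: im)
  qed
  have out_area: "(\<integral>\<^sup>+z. ennreal ((norm (?q z))\<^sup>2) * indicator (- cball 0 l) z \<partial>lborel) = ennreal (pi * (l / n)\<^sup>2)"
  proof -
    have dnz: "z - z0 \<noteq> 0" if "z \<in> - cball 0 l" for z using denominator_out_nonzero[OF z0, of z] that by simp
    have im: "(\<lambda>z. 1 / (z - z0)) ` (- cball 0 l) = ball (cnj z0 / of_real n) (l / n) - {0}"
      using image_exterior_inverse by (simp add: n_def)
    \<comment> \<open>The missing point 0 does not change the area.\<close>
    have area: "emeasure lborel ((\<lambda>z. 1 / (z - z0)) ` (- cball 0 l)) = ennreal (pi * (l / n)\<^sup>2)"
      unfolding im using n l by (subst emeasure_Diff_null_set) (auto simp: emeasure_lborel_ball_complex)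
    show ?thesis
      unfolding area[symmetric]
    proof (rule nn_integral_norm_deriv_eq_area)
      show "((\<lambda>z. 1 / (z - z0)) has_field_derivative ?q z) (at z)" if "z \<in> - cball 0 l" for z
        using dnz[OF that] by (auto intro!: derivative_eq_intros simp: field_simps power2_eq_square)
      show "continuous_on (- cball 0 l) ?q" using dnz by (intro continuous_intros) auto
      show "inj_on (\<lambda>z. 1 / (z - z0)) (- cball 0 l)"
        by (rule inj_onI) (use dnz in \<open>simp add: frac_eq_eq\<close>)
      show "emeasure lborel ((\<lambda>z. 1 / (z - z0)) ` (- cball 0 l)) < \<infinity>" unfolding area by simp
    qed (simp_all add: im open_Compl)
  qed
  \<comment> \<open>On the circle both indicators of the splitting vanish, so the equality of
    integrands holds only almost everywhere.\<close>
  have "AE z in lebesgue. z \<notin> sphere (0::complex) l"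
    using negligible_sphere by (intro AE_not_in) (simp add: negligible_iff_null_sets)
  then have ae: "AE z in lborel. z \<notin> sphere (0::complex) l" by (simp add: AE_completion_iff)
  have "dirichlet_energy (u_map l z0)
      = (\<integral>\<^sup>+z. ennreal (\<Sum>e\<in>Basis. (norm (u_deriv l z0 z e))\<^sup>2) \<partial>lborel)"
    using dirichlet_energy_eq[of "u_map l z0" "\<lambda>e z. u_deriv l z0 z e"] has_weak_partial_u_map(1)[OF z0]
    by (simp add: nn_integral_completion)
  \<comment> \<open>The 8 is 2 times 4: both basis directions contribute equally, since the
    derivative is multiplication up to conjugation, and \<open>?p\<close>, \<open>?q\<close> omit
    the factor 2 of the map.\<close>
  also have "\<dots> = (\<integral>\<^sup>+z. 8 * (ennreal ((norm (?p z))\<^sup>2) * indicator (ball 0 l) z)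
      + 8 * (ennreal ((norm (?q z))\<^sup>2) * indicator (- cball 0 l) z) \<partial>lborel)"
  proof (rule nn_integral_cong_AE, use ae in eventually_elim)
    fix z :: complex assume z: "z \<notin> sphere 0 l"
    have two: "ennreal (4 * a + 4 * a) = 8 * ennreal a" for a :: real
      by (subst ennreal_numeral[symmetric], subst ennreal_mult'[symmetric]) auto
    have "norm (cnj z - cnj z0) = norm (z - z0)" by (metis complex_cnj_diff complex_mod_cnj)
    then have "(\<Sum>e\<in>Basis. (norm (u_deriv l z0 z e))\<^sup>2)
        = (if z \<in> ball 0 l then 4 * (norm (?p z))\<^sup>2 + 4 * (norm (?p z))\<^sup>2 else 4 * (norm (?q z))\<^sup>2 + 4 * (norm (?q z))\<^sup>2)"
      by (simp add: Basis_complex_def u_deriv_def norm_mult norm_divide norm_power power_mult_distrib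
          power_divide)
    then show "ennreal (\<Sum>e\<in>Basis. (norm (u_deriv l z0 z e))\<^sup>2)
        = 8 * (ennreal ((norm (?p z))\<^sup>2) * indicator (ball 0 l) z)
          + 8 * (ennreal ((norm (?q z))\<^sup>2) * indicator (- cball 0 l) z)"
      using z by (cases "z \<in> ball 0 l") (simp_all only: two if_True if_False, auto)
  qed
  also have "\<dots> = 8 * ennreal (pi * (l / n)\<^sup>2) + 8 * ennreal (pi * (l / n)\<^sup>2)"
  proof -
    have ph: "(\<lambda>z. indicator (ball 0 l) z *\<^sub>R ?p z) \<in> borel_measurable borel"
      using denominator_in_nonzero[OF z0]
      by (intro borel_measurable_continuous_on_indicator continuous_intros) auto
    have qh: "(\<lambda>z. indicator (- cball 0 l) z *\<^sub>R ?q z) \<in> borel_measurable borel"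
      using denominator_out_nonzero[OF z0]
      by (intro borel_measurable_continuous_on_indicator continuous_intros) auto
    have meas: "(\<lambda>z. ennreal ((norm (f z))\<^sup>2) * indicator S z) \<in> borel_measurable lborel"
      if "(\<lambda>z. indicator S z *\<^sub>R f z) \<in> borel_measurable borel" for f :: "complex \<Rightarrow> complex" and S
    proof -
      have "(\<lambda>w::complex. ennreal ((norm w)\<^sup>2)) \<in> borel_measurable borel" by measurable
      from measurable_compose[OF that this]
      have "(\<lambda>z. ennreal ((norm (indicator S z *\<^sub>R f z))\<^sup>2)) \<in> borel_measurable lborel" by simp
      moreover have "ennreal ((norm (indicator S z *\<^sub>R f z))\<^sup>2) = ennreal ((norm (f z))\<^sup>2) * indicator S z" for z
        by (simp add: indicator_def)
      ultimately show ?thesis by (simp only:)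
    qed
    note m = meas[OF ph] meas[OF qh]
    show ?thesis
      using m by (simp only: nn_integral_add nn_integral_cmult borel_measurable_times_ennreal
          borel_measurable_const in_area out_area)
  qed
  also have "\<dots> = ennreal (16 * pi * l\<^sup>2 / n\<^sup>2)"
  proof -
    have "8 * ennreal (pi * (l / n)\<^sup>2) + 8 * ennreal (pi * (l / n)\<^sup>2)
        = ennreal (8 * (pi * (l / n)\<^sup>2)) + ennreal (8 * (pi * (l / n)\<^sup>2))"
      by (simp add: ennreal_mult')
    also have "\<dots> = ennreal (8 * (pi * (l / n)\<^sup>2) + 8 * (pi * (l / n)\<^sup>2))"
      by (rule ennreal_plus[symmetric]) auto
    finally show ?thesis by (simp add: power_divide)
  qed
  finally show ?thesis by (simp add: n_def)
qed

end

section \<open>The limiting energy\<close>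

text \<open>Discs of squared radius \<open>s\<close> have area \<open>\<pi> s\<close>.\<close>

lemma distr_norm_power2:
  "distr lborel borel (\<lambda>z::complex. (norm z)\<^sup>2) = density lborel (\<lambda>s. ennreal pi * indicator {0..} s)"
  (is "?M = ?N")
proof (rule measure_eqI_generator_eq)
  let ?E = "range (\<lambda>a::real. {..a})"
  show "Int_stable ?E" by (auto simp: Int_stable_def)
  show "?E \<subseteq> Pow UNIV" "sets ?M = sigma_sets UNIV ?E" "sets ?N = sigma_sets UNIV ?E"
    by (simp_all add: borel_eq_atMost)
  have M: "emeasure ?M {..a} = ennreal (pi * max 0 a)" for a
  proof -
    have m: "(\<lambda>z::complex. (norm z)\<^sup>2) \<in> borel_measurable borel" by measurable
    have "(norm z)\<^sup>2 \<le> a \<longleftrightarrow> norm z \<le> sqrt a" for z :: complex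
      using sqrt_ge_absD[of "norm z" a] real_le_rsqrt[of "norm z" a] by auto
    moreover have "\<not> norm z \<le> sqrt a" if "a < 0" for z :: complex
      using that real_sqrt_lt_0_iff[of a] norm_ge_zero[of z] by linarith
    ultimately have "(\<lambda>z::complex. (norm z)\<^sup>2) -` {..a} = (if a < 0 then {} else cball 0 (sqrt a))"
      by auto
    then show ?thesis
      using emeasure_cball[of "sqrt a" "0::complex"] m
      by (auto simp: emeasure_distr unit_ball_vol_2)
  qed
  have N: "emeasure ?N {..a} = ennreal (pi * max 0 a)" for a
  proof -
    have "emeasure ?N {..a} = (\<integral>\<^sup>+s. ennreal pi * indicator {0..} s * indicator {..a} s \<partial>lborel)"
      by (rule emeasure_density) auto
    also have "\<dots> = (\<integral>\<^sup>+s. ennreal pi * indicator {0..a} s \<partial>lborel)"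
      by (intro nn_integral_cong) (auto simp: indicator_def)
    also have "\<dots> = ennreal pi * emeasure lborel {0..a}" by (simp add: nn_integral_cmult_indicator)
    also have "\<dots> = ennreal (pi * max 0 a)"
      by (cases "0 \<le> a") (auto simp: ennreal_mult')
    finally show ?thesis .
  qed
  show "emeasure ?M X = emeasure ?N X" if "X \<in> ?E" for X using that M N by auto
  show "range (\<lambda>n::nat. {..real n}) \<subseteq> ?E" by auto
  show "(\<Union>n::nat. {..real n}) = UNIV" by (auto intro: real_arch_simple)
  show "emeasure ?M {..real n} \<noteq> \<infinity>" for n :: nat unfolding M by simp
qed

text \<open>Polar coordinates in the variable s = |z|^2, in which the density is the constant pi and
  no factor of the radius appears.\<close>

lemma nn_integral_radial:
  assumes "g \<in> borel_measurable borel"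
  shows "(\<integral>\<^sup>+z. g ((norm (z::complex))\<^sup>2) \<partial>lborel) = ennreal pi * (\<integral>\<^sup>+s. g s * indicator {0..} s \<partial>lborel)"
proof -
  have "(\<integral>\<^sup>+z. g ((norm (z::complex))\<^sup>2) \<partial>lborel) = (\<integral>\<^sup>+s. g s \<partial>distr lborel borel (\<lambda>z::complex. (norm z)\<^sup>2))"
    by (rule nn_integral_distr[symmetric]) (use assms in auto)
  also have "\<dots> = (\<integral>\<^sup>+s. (ennreal pi * indicator {0..} s) * g s \<partial>lborel)"
    unfolding distr_norm_power2 by (rule nn_integral_density) (use assms in auto)
  also have "\<dots> = (\<integral>\<^sup>+s. ennreal pi * (g s * indicator {0..} s) \<partial>lborel)"
    by (simp add: mult_ac)
  also have "\<dots> = ennreal pi * (\<integral>\<^sup>+s. g s * indicator {0..} s \<partial>lborel)"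
    by (rule nn_integral_cmult) (use assms in auto)
  finally show ?thesis .
qed

lemma has_derivative_Phi_3:
  "((\<lambda>y. Phi y $ 3) has_derivative (\<lambda>h. - 4 * (x \<bullet> h) / (1 + (norm x)\<^sup>2)\<^sup>2)) (at x)"
proof -
  have pos: "1 + x \<bullet> x \<noteq> 0" for x :: complex by (metis add_pos_nonneg inner_ge_zero less_irrefl zero_less_one)
  have "((\<lambda>y. (1 - y \<bullet> y) / (1 + y \<bullet> y)) has_derivative (\<lambda>h. - 4 * (x \<bullet> h) / (1 + x \<bullet> x)\<^sup>2)) (at x)"
    using pos[of x]
    by (auto intro!: derivative_eq_intros simp: fun_eq_iff field_simps power2_eq_square inner_commute)
  then show ?thesis by (simp add: Phi_def power2_norm_eq_inner)
qed

text \<open>Both vectors are negative multiples of x, namely -2 x / (1 + |x|^2) and -4 x / (1 +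
  |x|^2)^2, so the integrand is radial and nonnegative.\<close>

lemma horizontal_Phi_inner_grad:
  "horizontal (mat 1 *v Phi x) \<bullet> grad (\<lambda>y. Phi y $ 3) x = 8 * (norm x)\<^sup>2 / (1 + (norm x)\<^sup>2) ^ 3"
proof -
  define d where "d = 1 + (norm x)\<^sup>2"
  have d: "d > 0" by (simp add: d_def add_pos_nonneg)
  have fd: "frechet_derivative (\<lambda>y. Phi y $ 3) (at x) = (\<lambda>h. - 4 * (x \<bullet> h) / d\<^sup>2)"
    using frechet_derivative_at[OF has_derivative_Phi_3[of x]] by (simp add: d_def)
  have "grad (\<lambda>y. Phi y $ 3) x = (- 4 / d\<^sup>2) *\<^sub>R x"
    unfolding grad_def fd by (simp add: Basis_complex_def complex_eq_iff)
  moreover have "horizontal (mat 1 *v Phi x) = (- 2 / d) *\<^sub>R x"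
    by (simp add: horizontal_def Phi_def matrix_vector_mul_lid complex_eq_iff d_def)
  ultimately have "horizontal (mat 1 *v Phi x) \<bullet> grad (\<lambda>y. Phi y $ 3) x = 8 * (x \<bullet> x) / (d * d\<^sup>2)"
    by simp
  also have "d * d\<^sup>2 = d ^ 3" by (simp add: power3_eq_cube power2_eq_square)
  finally show ?thesis unfolding d_def power2_norm_eq_inner .
qed

text \<open>In s = |x|^2 this is pi times the integral of 8 s / (1 + s)^3 over s \<ge> 0; the
  antiderivative 4 (s / (1 + s))^2 rises from 0 to 4.\<close>

lemma skyrmion_integral:
  "(\<integral>x. horizontal (mat 1 *v Phi x) \<bullet> grad (\<lambda>y. Phi y $ 3) x \<partial>lebesgue) = 4 * pi"
proof -
  let ?g = "\<lambda>s::real. 8 * s / (1 + s) ^ 3"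
  have "(\<integral>\<^sup>+s. ennreal (?g s) * indicator {0..} s \<partial>lborel) = ennreal (4 - 4 * (0 / (1 + 0))\<^sup>2)"
  proof (rule nn_integral_FTC_atLeast)
    show "?g \<in> borel_measurable borel" by measurable
    show "((\<lambda>s. 4 * (s / (1 + s))\<^sup>2) has_real_derivative ?g s) (at s)" if "0 \<le> s" for s
    proof -
      have nz: "1 + s \<noteq> 0" using that by simp
      have "((\<lambda>s. s / (1 + s)) has_real_derivative 1 / (1 + s)\<^sup>2) (at s)"
        using nz by (auto intro!: derivative_eq_intros simp: power2_eq_square)
      from DERIV_cmult[OF DERIV_power[OF this, of 2], of 4]
      show ?thesis by (rule DERIV_cong) (use nz in \<open>simp add: field_simps power2_eq_square power3_eq_cube\<close>)
    qed
    show "0 \<le> ?g s" if "0 \<le> s" for s using that by simp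
    show "((\<lambda>s::real. 4 * (s / (1 + s))\<^sup>2) \<longlongrightarrow> 4) at_top"
    proof (rule Lim_transform_eventually)
      have "((\<lambda>s::real. inverse (1 + s)) \<longlongrightarrow> 0) at_top"
        by (intro tendsto_inverse_0_at_top filterlim_tendsto_add_at_top[OF tendsto_const filterlim_ident])
      then have "((\<lambda>s::real. 4 * (1 - inverse (1 + s))\<^sup>2) \<longlongrightarrow> 4 * (1 - 0)\<^sup>2) at_top"
        by (intro tendsto_intros)
      then show "((\<lambda>s::real. 4 * (1 - inverse (1 + s))\<^sup>2) \<longlongrightarrow> 4) at_top" by simp
      show "\<forall>\<^sub>F s::real in at_top. 4 * (1 - inverse (1 + s))\<^sup>2 = 4 * (s / (1 + s))\<^sup>2"
        using eventually_gt_at_top[of 0] by eventually_elim (simp add: field_simps)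
    qed
  qed
  then have "(\<integral>\<^sup>+s. ennreal (?g s) * indicator {0..} s \<partial>lborel) = 4" by simp
  then have nn: "(\<integral>\<^sup>+z. ennreal (?g ((norm (z::complex))\<^sup>2)) \<partial>lborel) = ennreal (4 * pi)"
    using nn_integral_radial[of "\<lambda>s. ennreal (?g s)"] by (simp add: ennreal_mult' mult.commute)
  have m: "(\<lambda>z::complex. ?g ((norm z)\<^sup>2)) \<in> borel_measurable lborel" by measurable
  have "(\<integral>x. horizontal (mat 1 *v Phi x) \<bullet> grad (\<lambda>y. Phi y $ 3) x \<partial>lebesgue)
      = (\<integral>z. ?g ((norm (z::complex))\<^sup>2) \<partial>lborel)"
    unfolding horizontal_Phi_inner_grad by (rule integral_completion[OF m])
  also have "\<dots> = enn2real (\<integral>\<^sup>+z. ennreal (?g ((norm (z::complex))\<^sup>2)) \<partial>lborel)"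
    by (rule integral_eq_nn_integral[OF m]) (simp add: add_nonneg_nonneg)
  finally show ?thesis unfolding nn by simp
qed

section \<open>Minimality, uniqueness and the value of the infimum\<close>

lemma u_map_unique_minimiser:
  assumes "norm z0 < l"
  shows "achieves_T (ball 0 l) z0 (u_map l z0)"
    and "achieves_T (ball 0 l) z0 v \<Longrightarrow> AE z in lebesgue. v z = u_map l z0 z"
    and "T (ball 0 l) z0 = ennreal (16 * pi * l\<^sup>2 / (l\<^sup>2 - (norm z0)\<^sup>2)\<^sup>2)"
proof -
  note energy = dirichlet_energy_u_map[OF assms]
  have fin: "dirichlet_energy (u_map l z0) < \<infinity>" by (simp add: energy)
  have "dirichlet_energy (u_map l z0) \<le> dirichlet_energy v" if "v \<in> admissible (ball 0 l) z0" for v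
    using dirichlet_energy_admissible[OF assms fin that] by (metis le_iff_add)
  then have T: "T (ball 0 l) z0 = dirichlet_energy (u_map l z0)"
    unfolding T_def by (intro antisym INF_lower u_map_admissible assms INF_greatest)
  then show "achieves_T (ball 0 l) z0 (u_map l z0)"
    using u_map_admissible[OF assms] by (simp add: achieves_T_def)
  show "T (ball 0 l) z0 = ennreal (16 * pi * l\<^sup>2 / (l\<^sup>2 - (norm z0)\<^sup>2)\<^sup>2)"
    unfolding T energy ..
  assume v: "achieves_T (ball 0 l) z0 v"
  then have "v \<in> admissible (ball 0 l) z0" by (simp add: achieves_T_def)
  then obtain B where B: "0 \<le> B" "dirichlet_energy v = dirichlet_energy (u_map l z0) + ennreal B"
      "B = 0 \<Longrightarrow> AE z in lebesgue. v z = u_map l z0 z"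
    using dirichlet_energy_admissible[OF assms fin] by metis
  \<comment> \<open>Written as a sum with 0 so that the energy can be cancelled, which in
    \<open>ennreal\<close> requires it to be finite.\<close>
  have "dirichlet_energy (u_map l z0) + ennreal B = dirichlet_energy (u_map l z0) + 0"
    using v B(2) by (simp add: achieves_T_def T)
  then have "ennreal B = 0" using fin by (subst (asm) ennreal_add_left_cancel) auto
  then show "AE z in lebesgue. v z = u_map l z0 z" using B by (simp add: ennreal_eq_0_iff)
qed

theorem proposition2p10:
  fixes l :: real and z0 :: complex and \<Omega> :: "complex set"
  assumes l_pos: "l > 0"
    and Omega: "\<Omega> = ball 0 l"
    and z0: "z0 \<in> \<Omega>"
  shows "achieves_T \<Omega> z0 (u_map l z0)
    \<and> (\<forall>v. achieves_T \<Omega> z0 v \<longrightarrow> (AE z in lebesgue. v z = u_map l z0 z))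
    \<and> T \<Omega> z0 = ennreal (16 * pi * l\<^sup>2 / (l\<^sup>2 - (norm z0)\<^sup>2)\<^sup>2)
    \<and> (\<forall>z. is_arg_min (T \<Omega>) (\<lambda>w. w \<in> \<Omega>) z \<longleftrightarrow> z = 0)
    \<and> T \<Omega> 0 = ennreal (16 * pi / l\<^sup>2)
    \<and> (\<forall>r. is_arg_min (\<lambda>s. E0 \<Omega> (mat 1) s 0) (\<lambda>s. s > 0) r \<longleftrightarrow> r = l\<^sup>2 / 4)
    \<and> 4 * pi / enn2real (T \<Omega> 0) = l\<^sup>2 / 4
    \<and> E0 \<Omega> (mat 1) (l\<^sup>2 / 4) 0 = - pi * l\<^sup>2"
proof -
  have T: "T \<Omega> z = ennreal (16 * pi * l\<^sup>2 / (l\<^sup>2 - (norm z)\<^sup>2)\<^sup>2)" if "norm z < l" for z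
    using u_map_unique_minimiser(3)[OF that] Omega by simp
  have T0: "T \<Omega> 0 = ennreal (16 * pi / l\<^sup>2)"
    using T[of 0] l_pos by (simp add: power2_eq_square field_simps)
  have T0': "enn2real (T \<Omega> 0) = 16 * pi / l\<^sup>2" by (simp add: T0)
  \<comment> \<open>The centre enters only through l^2 - |z|^2 in the denominator, which is positive
    in the disc and largest exactly at z = 0.\<close>
  have less: "T \<Omega> 0 < T \<Omega> z" if z: "norm z < l" "z \<noteq> 0" for z
  proof -
    have pos: "0 < l\<^sup>2 - (norm z)\<^sup>2" by (rule l_power2_minus_pos[OF z(1)])
    have "(l\<^sup>2 - (norm z)\<^sup>2)\<^sup>2 < (l\<^sup>2)\<^sup>2"
      using z pos by (intro power_strict_mono) auto
    then have "16 * pi * l\<^sup>2 / (l\<^sup>2)\<^sup>2 < 16 * pi * l\<^sup>2 / (l\<^sup>2 - (norm z)\<^sup>2)\<^sup>2"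
      using pos l_pos by (intro divide_strict_left_mono mult_pos_pos zero_less_power) auto
    then show ?thesis using T[of 0] T[OF z(1)] l_pos by (simp add: ennreal_less_iff)
  qed
  have argmin_T: "is_arg_min (T \<Omega>) (\<lambda>w. w \<in> \<Omega>) z \<longleftrightarrow> z = 0" for z
  proof
    assume "is_arg_min (T \<Omega>) (\<lambda>w. w \<in> \<Omega>) z"
    then show "z = 0" using less[of z] l_pos by (auto simp: is_arg_min_def Omega)
  next
    assume z: "z = 0"
    have "\<not> T \<Omega> w < T \<Omega> 0" if "norm w < l" for w
      using less[OF that] by (cases "w = 0") (auto dest: less_asym)
    then show "is_arg_min (T \<Omega>) (\<lambda>w. w \<in> \<Omega>) z" using z l_pos by (auto simp: is_arg_min_def Omega)
  qed
  \<comment> \<open>Completing the square in (16 pi / l^2) s^2 - 8 pi s, where 8 pi is twice the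
    integral 4 pi; the minimiser and the minimal value can be read off.\<close>
  have E0: "E0 \<Omega> (mat 1) s 0 = 16 * pi / l\<^sup>2 * (s - l\<^sup>2 / 4)\<^sup>2 - pi * l\<^sup>2" for s
    unfolding E0_def T0' skyrmion_integral using l_pos
    by (simp add: field_simps power2_eq_square)
  have argmin_E0: "is_arg_min (\<lambda>s. E0 \<Omega> (mat 1) s 0) (\<lambda>s. s > 0) r \<longleftrightarrow> r = l\<^sup>2 / 4" for r
  proof
    assume r: "is_arg_min (\<lambda>s. E0 \<Omega> (mat 1) s 0) (\<lambda>s. s > 0) r"
    then have "\<not> E0 \<Omega> (mat 1) (l\<^sup>2 / 4) 0 < E0 \<Omega> (mat 1) r 0"
      using l_pos by (auto simp: is_arg_min_def)
    then have "16 * pi / l\<^sup>2 * (r - l\<^sup>2 / 4)\<^sup>2 \<le> 0" by (simp add: E0)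
    then show "r = l\<^sup>2 / 4" using l_pos pi_gt_zero by (simp add: mult_le_0_iff divide_le_0_iff)
  next
    assume r: "r = l\<^sup>2 / 4"
    have "E0 \<Omega> (mat 1) (l\<^sup>2 / 4) 0 \<le> E0 \<Omega> (mat 1) s 0" for s by (simp add: E0)
    then show "is_arg_min (\<lambda>s. E0 \<Omega> (mat 1) s 0) (\<lambda>s. s > 0) r"
      unfolding r is_arg_min_def using l_pos by (auto simp: not_less)
  qed
  have z0': "norm z0 < l" using z0 Omega by simp
  show ?thesis
    using u_map_unique_minimiser[OF z0'] argmin_T T0 argmin_E0 T0' l_pos
    by (auto simp: Omega E0[unfolded Omega])
qed

end
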